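(* Let $R$ be an associative ring with identity. If $R$ is right simple injective, satisfies the ascending chain condition on right annihilators, and its right socle $S_r$ is essential in $R_R$, then $R$ is quasi-Frobenius.
   Context: Rings are associative with identity. A ring $R$ is quasi-Frobenius (QF) if $R$ is left or right noetherian and left or right self-injective (any choice of sides gives the same class of rings). $R$ is right simple injective if every right $R$-homomorphism from a right ideal of $R$ to $R$ with simple image is given by left multiplication by an element of $R$. A right annihilator is a right ideal of the form $\mathbf{r}(X)=\{r\in R: xr=0\text{ for all }x\in X\}$ with $X\subseteq R$. $S_r$ denotes the right socle of $R$, i.e. the socle of the right module $R_R$ (the sum of all minimal right ideals). *)

theory Defs
  imports "HOL-Algebra.AbelCoset"
begin

text \<open>
  The module theory of HOL-Algebra is restricted to commutative rings, so right modules over an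
  arbitrary ring are introduced here. As for the library's record of modules, the multiplicative
  fields that the module record inherits from the ring record carry no meaning.
\<close>

record ('a, 'm) right_module = "'m ring" +
  rsmult :: "['m, 'a] \<Rightarrow> 'm"  (infixl \<open>\<cdot>\<index>\<close> 70)

locale right_module = R?: ring R + M?: abelian_group M
  for R (structure) and M (structure) +
  assumes rsmult_closed:
      "\<lbrakk>x \<in> carrier M; a \<in> carrier R\<rbrakk> \<Longrightarrow> x \<cdot>\<^bsub>M\<^esub> a \<in> carrier M"
    and rsmult_r_distr:
      "\<lbrakk>x \<in> carrier M; a \<in> carrier R; b \<in> carrier R\<rbrakk>
        \<Longrightarrow> x \<cdot>\<^bsub>M\<^esub> (a \<oplus>\<^bsub>R\<^esub> b) = x \<cdot>\<^bsub>M\<^esub> a \<oplus>\<^bsub>M\<^esub> x \<cdot>\<^bsub>M\<^esub> b"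
    and rsmult_l_distr:
      "\<lbrakk>x \<in> carrier M; y \<in> carrier M; a \<in> carrier R\<rbrakk>
        \<Longrightarrow> (x \<oplus>\<^bsub>M\<^esub> y) \<cdot>\<^bsub>M\<^esub> a = x \<cdot>\<^bsub>M\<^esub> a \<oplus>\<^bsub>M\<^esub> y \<cdot>\<^bsub>M\<^esub> a"
    and rsmult_assoc:
      "\<lbrakk>x \<in> carrier M; a \<in> carrier R; b \<in> carrier R\<rbrakk>
        \<Longrightarrow> x \<cdot>\<^bsub>M\<^esub> (a \<otimes>\<^bsub>R\<^esub> b) = (x \<cdot>\<^bsub>M\<^esub> a) \<cdot>\<^bsub>M\<^esub> b"
    and rsmult_one: "x \<in> carrier M \<Longrightarrow> x \<cdot>\<^bsub>M\<^esub> \<one>\<^bsub>R\<^esub> = x"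

definition right_submodule ::
    "('a, 'b) ring_scheme \<Rightarrow> 'm set \<Rightarrow> ('a, 'm, 'c) right_module_scheme \<Rightarrow> bool" where
  "right_submodule R N M \<longleftrightarrow>
     additive_subgroup N M \<and> (\<forall>x\<in>N. \<forall>a\<in>carrier R. x \<cdot>\<^bsub>M\<^esub> a \<in> N)"

definition right_module_hom ::
    "('a, 'b) ring_scheme \<Rightarrow> ('a, 'm, 'c) right_module_scheme \<Rightarrow> ('a, 'n, 'd) right_module_scheme
      \<Rightarrow> ('m \<Rightarrow> 'n) set" where
  "right_module_hom R M N =
     {f. f \<in> carrier M \<rightarrow> carrier N
       \<and> (\<forall>x\<in>carrier M. \<forall>y\<in>carrier M. f (x \<oplus>\<^bsub>M\<^esub> y) = f x \<oplus>\<^bsub>N\<^esub> f y)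
       \<and> (\<forall>x\<in>carrier M. \<forall>a\<in>carrier R. f (x \<cdot>\<^bsub>M\<^esub> a) = f x \<cdot>\<^bsub>N\<^esub> a)}"

definition simple_right_module ::
    "('a, 'b) ring_scheme \<Rightarrow> ('a, 'm, 'c) right_module_scheme \<Rightarrow> bool" where
  "simple_right_module R M \<longleftrightarrow>
     right_module R M \<and> carrier M \<noteq> {\<zero>\<^bsub>M\<^esub>} \<and>
     (\<forall>N. right_submodule R N M \<longrightarrow> N = {\<zero>\<^bsub>M\<^esub>} \<or> N = carrier M)"

definition essential_right_submodule ::
    "('a, 'b) ring_scheme \<Rightarrow> 'm set \<Rightarrow> ('a, 'm, 'c) right_module_scheme \<Rightarrow> bool" where
  "essential_right_submodule R N M \<longleftrightarrow>
     right_submodule R N M \<and>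
     (\<forall>K. right_submodule R K M \<and> K \<noteq> {\<zero>\<^bsub>M\<^esub>} \<longrightarrow> N \<inter> K \<noteq> {\<zero>\<^bsub>M\<^esub>})"

text \<open>
  The definition of injectivity quantifies over all modules, which in HOL is only possible for
  modules whose elements live in one fixed type; that type is made an explicit argument.
  A module is injective in the usual sense if this predicate holds for every choice
  of \<open>'m\<close>, so theorems concluding injectivity leave \<open>'m\<close> as a free type variable.
\<close>

definition injective_right_module ::
    "'m itself \<Rightarrow> ('a, 'b) ring_scheme \<Rightarrow> ('a, 'e, 'c) right_module_scheme \<Rightarrow> bool" where
  "injective_right_module (_ :: 'm itself) R E \<longleftrightarrow>
     right_module R E \<and>
     (\<forall>(M :: ('a, 'm) right_module) N f.
        right_module R M \<and> right_submodule R N M \<and>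
        f \<in> right_module_hom R (M\<lparr>carrier := N\<rparr>) E \<longrightarrow>
        (\<exists>g\<in>right_module_hom R M E. \<forall>x\<in>N. g x = f x))"

text \<open>The right regular module \<open>R\<^sub>R\<close>.\<close>

definition regular_right_module :: "('a, 'b) ring_scheme \<Rightarrow> ('a, 'a) right_module" where
  "regular_right_module R =
     \<lparr>carrier = carrier R, mult = mult R, one = one R, zero = zero R, add = add R,
      rsmult = mult R\<rparr>"

abbreviation right_ideal :: "('a, 'b) ring_scheme \<Rightarrow> 'a set \<Rightarrow> bool" where
  "right_ideal R I \<equiv> right_submodule R I (regular_right_module R)"

definition minimal_right_ideal :: "('a, 'b) ring_scheme \<Rightarrow> 'a set \<Rightarrow> bool" where
  "minimal_right_ideal R K \<longleftrightarrow>
     right_ideal R K \<and> simple_right_module R ((regular_right_module R)\<lparr>carrier := K\<rparr>)"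

definition right_socle :: "('a, 'b) ring_scheme \<Rightarrow> 'a set" where
  "right_socle R =
     {(\<Oplus>\<^bsub>R\<^esub>K\<in>F. f K) | F f.
        finite F \<and> (\<forall>K\<in>F. minimal_right_ideal R K \<and> f K \<in> K)}"

definition right_simple_injective :: "('a, 'b) ring_scheme \<Rightarrow> bool" where
  "right_simple_injective R \<longleftrightarrow>
     (\<forall>I f. right_ideal R I \<and>
        f \<in> right_module_hom R ((regular_right_module R)\<lparr>carrier := I\<rparr>) (regular_right_module R) \<and>
        simple_right_module R ((regular_right_module R)\<lparr>carrier := f ` I\<rparr>) \<longrightarrow>
        (\<exists>a\<in>carrier R. \<forall>x\<in>I. f x = a \<otimes>\<^bsub>R\<^esub> x))"

definition right_annihilator :: "('a, 'b) ring_scheme \<Rightarrow> 'a set \<Rightarrow> 'a set" where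
  "right_annihilator R X = {r \<in> carrier R. \<forall>x\<in>X. x \<otimes>\<^bsub>R\<^esub> r = \<zero>\<^bsub>R\<^esub>}"

definition ascending_chain_condition :: "'a set set \<Rightarrow> bool" where
  "ascending_chain_condition \<S> \<longleftrightarrow>
     (\<forall>I :: nat \<Rightarrow> 'a set. (\<forall>n. I n \<in> \<S>) \<and> (\<forall>n. I n \<subseteq> I (Suc n)) \<longrightarrow>
        (\<exists>m. \<forall>n\<ge>m. I n = I m))"

definition acc_right_annihilators :: "('a, 'b) ring_scheme \<Rightarrow> bool" where
  "acc_right_annihilators R \<longleftrightarrow>
     ascending_chain_condition {right_annihilator R X | X. X \<subseteq> carrier R}"

definition right_noetherian :: "('a, 'b) ring_scheme \<Rightarrow> bool" where
  "right_noetherian R \<longleftrightarrow> ascending_chain_condition {I. right_ideal R I}"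

definition right_self_injective :: "'m itself \<Rightarrow> ('a, 'b) ring_scheme \<Rightarrow> bool" where
  "right_self_injective T R \<longleftrightarrow> injective_right_module T R (regular_right_module R)"

text \<open>
  Left modules over \<open>R\<close> are right modules over the opposite ring, and left ideals of \<open>R\<close> are
  its right ideals.
\<close>

definition opposite_ring :: "('a, 'b) ring_scheme \<Rightarrow> ('a, 'b) ring_scheme" where
  "opposite_ring R = R\<lparr>mult := (\<lambda>x y. y \<otimes>\<^bsub>R\<^esub> x)\<rparr>"

definition left_noetherian :: "('a, 'b) ring_scheme \<Rightarrow> bool" where
  "left_noetherian R \<longleftrightarrow> right_noetherian (opposite_ring R)"

definition left_self_injective :: "'m itself \<Rightarrow> ('a, 'b) ring_scheme \<Rightarrow> bool" where
  "left_self_injective T R \<longleftrightarrow> right_self_injective T (opposite_ring R)"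

definition quasi_frobenius :: "'m itself \<Rightarrow> ('a, 'b) ring_scheme \<Rightarrow> bool" where
  "quasi_frobenius T R \<longleftrightarrow>
     ring R \<and>
     (left_noetherian R \<or> right_noetherian R) \<and>
     (left_self_injective T R \<or> right_self_injective T R)"

end

theory Submission
  imports Defs "HOL-Algebra.Multiplicative_Group"
begin

text \<open>
  Write \<open>S\<close> for the right socle and \<open>J\<close> for its left annihilator. The plan is to show that \<open>R\<close> is
  semiprimary with radical \<open>J\<close>, that every simple right module embeds in \<open>R\<close>, and to deduce from
  this that \<open>R\<close> is right noetherian and right self-injective.

  Simple injectivity enters only through \<open>simple_extension\<close>: a homomorphism that vanishes on a right
  ideal \<open>T\<close> and sends one further element \<open>x\<close> to a generator of a minimal right ideal is a left
  multiplication. For \<open>T = 0\<close> this shows that \<open>Rk\<close> is a simple left module whenever \<open>kR\<close> is a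
  simple right module.

  Since \<open>S\<close> is essential, elements of \<open>J\<close> have essential right annihilators, and the chain condition
  then forces \<open>J\<close> to be nilpotent (\<open>socle_annihilator_nilpotent\<close>); hence \<open>S J = 0\<close>. The chain condition
  on right annihilators is a descending chain condition on left annihilators, so \<open>J\<close> is already the
  left annihilator of finitely many generators \<open>x\<close> of minimal right ideals. Therefore \<open>R/J\<close> embeds
  into the direct sum of the simple left modules \<open>Rx\<close> and is semisimple. A minimal such family
  yields orthogonal primitive idempotents \<open>e x\<close> of \<open>R/J\<close> that sum to \<open>1\<close>.

  That simple right modules embed in \<open>R\<close> is a counting argument. Each generator \<open>x\<close> is fixed on the
  left by \<open>e x\<close>, and \<open>x e z \<noteq> 0\<close> for some \<open>z\<close>, which records the isomorphism type of \<open>xR\<close>. Isomorphic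
  minimal right ideals are left multiples of each other, so the block of \<open>z\<close> determines the block of
  \<open>x\<close>. An assignment between the finitely many blocks of \<open>R/J\<close> that reflects equality is onto, so every
  isomorphism type of simple right modules occurs in \<open>S\<close> (\<open>socle_component\<close>,
  \<open>maximal_right_ideal_left_annihilated\<close>).

  It follows that every right ideal is a right annihilator: an element outside \<open>T\<close> is separated from
  \<open>T\<close> by a homomorphism onto a simple right ideal, and such homomorphisms are left multiplications. Thus
  the chain condition says that \<open>R\<close> is right noetherian. Finally let \<open>f\<close> be a homomorphism from a right
  ideal \<open>T\<close> to \<open>R\<close>. Take \<open>U\<close> maximal in \<open>T\<close> such that \<open>f\<close> is multiplication by some \<open>a\<close> on \<open>U\<close>. If
  \<open>U \<noteq> T\<close>, there is a larger \<open>V\<close> with \<open>V/U\<close> simple, and on \<open>V\<close> the difference of \<open>f\<close> and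
  multiplication by \<open>a\<close> kills \<open>U\<close>, so its image is simple or zero and \<open>simple_extension\<close> corrects
  \<open>a\<close>. Hence \<open>f\<close> is a multiplication on all of \<open>T\<close>, and Baer's criterion finishes the proof.
\<close>

section \<open>Submodules and right ideals, elementwise\<close>

context right_module
begin

lemma rsmult_zero_right: "x \<in> carrier M \<Longrightarrow> x \<cdot>\<^bsub>M\<^esub> \<zero>\<^bsub>R\<^esub> = \<zero>\<^bsub>M\<^esub>"
  using rsmult_r_distr[of x "\<zero>\<^bsub>R\<^esub>" "\<zero>\<^bsub>R\<^esub>"] rsmult_closed[of x "\<zero>\<^bsub>R\<^esub>"]
  by (simp add: M.add.l_cancel_one')

lemma rsmult_minus_one:
  assumes "x \<in> carrier M"
  shows "x \<cdot>\<^bsub>M\<^esub> (\<ominus>\<^bsub>R\<^esub> \<one>\<^bsub>R\<^esub>) = \<ominus>\<^bsub>M\<^esub> x"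
proof -
  have "x \<cdot>\<^bsub>M\<^esub> (\<ominus>\<^bsub>R\<^esub> \<one>\<^bsub>R\<^esub>) \<oplus>\<^bsub>M\<^esub> x = x \<cdot>\<^bsub>M\<^esub> (\<ominus>\<^bsub>R\<^esub> \<one>\<^bsub>R\<^esub> \<oplus>\<^bsub>R\<^esub> \<one>\<^bsub>R\<^esub>)"
    using assms by (simp add: rsmult_r_distr rsmult_one)
  also have "\<dots> = \<zero>\<^bsub>M\<^esub>" using assms by (simp add: R.l_neg rsmult_zero_right)
  finally show ?thesis
    using assms M.minus_equality rsmult_closed by (metis R.a_inv_closed R.one_closed)
qed

text \<open>
  Closure under negation is automatic, because negation is the action of \<open>-1\<close>. This reduces all
  submodule arguments below to closure conditions on elements.
\<close>

lemma right_submodule_iff: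
  "right_submodule R N M \<longleftrightarrow> N \<subseteq> carrier M \<and> \<zero>\<^bsub>M\<^esub> \<in> N \<and>
     (\<forall>x\<in>N. \<forall>y\<in>N. x \<oplus>\<^bsub>M\<^esub> y \<in> N) \<and> (\<forall>x\<in>N. \<forall>a\<in>carrier R. x \<cdot>\<^bsub>M\<^esub> a \<in> N)"
  (is "_ \<longleftrightarrow> ?E")
proof
  assume "right_submodule R N M"
  then show ?E
    unfolding right_submodule_def
    by (meson additive_subgroup.a_Hcarr additive_subgroup.a_closed
          additive_subgroup.zero_closed subsetI)
next
  assume E: ?E
  have "\<ominus>\<^bsub>M\<^esub> x \<in> N" if "x \<in> N" for x
    using that E rsmult_minus_one[of x] by (metis R.a_inv_closed R.one_closed subsetD)
  then have "subgroup N (add_monoid M)"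
    using E by (intro M.add.subgroupI) (auto simp: a_inv_def)
  then show "right_submodule R N M"
    using E unfolding right_submodule_def additive_subgroup_def by blast
qed

lemma right_module_restrict:
  assumes "right_submodule R N M"
  shows "right_module R (M\<lparr>carrier := N\<rparr>)"
proof -
  have sub: "N \<subseteq> carrier M" "\<zero>\<^bsub>M\<^esub> \<in> N" "\<And>x y. x \<in> N \<Longrightarrow> y \<in> N \<Longrightarrow> x \<oplus>\<^bsub>M\<^esub> y \<in> N"
    "\<And>x a. x \<in> N \<Longrightarrow> a \<in> carrier R \<Longrightarrow> x \<cdot>\<^bsub>M\<^esub> a \<in> N"
    using assms unfolding right_submodule_iff by auto
  have neg: "\<exists>y\<in>N. y \<oplus>\<^bsub>M\<^esub> x = \<zero>\<^bsub>M\<^esub>" if "x \<in> N" for x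
  proof
    show "\<ominus>\<^bsub>M\<^esub> x \<in> N"
      using that sub rsmult_minus_one[of x] by (metis R.a_inv_closed R.one_closed subsetD)
    show "\<ominus>\<^bsub>M\<^esub> x \<oplus>\<^bsub>M\<^esub> x = \<zero>\<^bsub>M\<^esub>" using that sub by (auto simp: M.l_neg)
  qed
  have "abelian_group (M\<lparr>carrier := N\<rparr>)"
    by (rule abelian_groupI) (use sub neg in \<open>auto simp: M.a_ac subset_iff\<close>)
  then show ?thesis
    unfolding right_module_def right_module_axioms_def
    using sub R.ring_axioms
    by (auto simp: rsmult_r_distr rsmult_l_distr rsmult_assoc rsmult_one subset_iff)
qed

end

context ring
begin

lemma right_module_regular: "right_module R (regular_right_module R)"
proof -
  have "abelian_group (regular_right_module R)"
    by (rule abelian_groupI)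
      (auto simp: regular_right_module_def a_ac intro: bexI[where x = "\<ominus> _"] l_neg)
  then show ?thesis
    unfolding right_module_def right_module_axioms_def
    using ring_axioms
    by (auto simp: regular_right_module_def r_distr l_distr m_assoc)
qed

lemma right_ideal_iff:
  "right_ideal R I \<longleftrightarrow> I \<subseteq> carrier R \<and> \<zero> \<in> I \<and>
     (\<forall>x\<in>I. \<forall>y\<in>I. x \<oplus> y \<in> I) \<and> (\<forall>x\<in>I. \<forall>a\<in>carrier R. x \<otimes> a \<in> I)"
  using right_module.right_submodule_iff[OF right_module_regular, of I]
  by (simp add: regular_right_module_def)

lemma right_ideal_minus:
  assumes "right_ideal R I" "x \<in> I" "y \<in> I"
  shows "x \<ominus> y \<in> I"
proof -
  have "y \<otimes> \<ominus> \<one> \<in> I" "y \<in> carrier R" using assms unfolding right_ideal_iff by auto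
  then have "\<ominus> y \<in> I" by (simp add: r_minus)
  then show ?thesis using assms unfolding right_ideal_iff by (simp add: minus_eq)
qed

lemma right_ideal_add_principal:
  assumes T: "right_ideal R T" and x: "x \<in> carrier R"
  shows "right_ideal R {t \<oplus> x \<otimes> r | t r. t \<in> T \<and> r \<in> carrier R}" (is "right_ideal R ?I")
    and "T \<subseteq> {t \<oplus> x \<otimes> r | t r. t \<in> T \<and> r \<in> carrier R}"
    and "x \<in> {t \<oplus> x \<otimes> r | t r. t \<in> T \<and> r \<in> carrier R}"
proof -
  have sub: "T \<subseteq> carrier R" "\<zero> \<in> T" "\<And>s t. s \<in> T \<Longrightarrow> t \<in> T \<Longrightarrow> s \<oplus> t \<in> T"
    "\<And>t a. t \<in> T \<Longrightarrow> a \<in> carrier R \<Longrightarrow> t \<otimes> a \<in> T"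
    using T unfolding right_ideal_iff by auto
  show T': "T \<subseteq> ?I"
  proof
    fix t assume "t \<in> T"
    moreover have "t = t \<oplus> x \<otimes> \<zero>" using \<open>t \<in> T\<close> sub(1) x by (auto simp: subset_iff)
    ultimately show "t \<in> ?I" by blast
  qed
  have "x = \<zero> \<oplus> x \<otimes> \<one>" using x by simp
  then show "x \<in> ?I" using sub(2) by blast
  have carr: "?I \<subseteq> carrier R" using sub(1) x by auto
  have add: "u \<oplus> v \<in> ?I" if uv: "u \<in> ?I" "v \<in> ?I" for u v
  proof -
    obtain s q t r where *: "s \<in> T" "t \<in> T" "q \<in> carrier R" "r \<in> carrier R"
      "u = s \<oplus> x \<otimes> q" "v = t \<oplus> x \<otimes> r" using uv by blast
    then have "s \<in> carrier R" "t \<in> carrier R" using sub(1) by auto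
    then have "u \<oplus> v = (s \<oplus> t) \<oplus> x \<otimes> (q \<oplus> r)"
      using * x by (simp add: r_distr a_ac)
    then show ?thesis using * sub(3) by blast
  qed
  have mult: "u \<otimes> a \<in> ?I" if u: "u \<in> ?I" and a: "a \<in> carrier R" for u a
  proof -
    obtain t r where *: "t \<in> T" "r \<in> carrier R" "u = t \<oplus> x \<otimes> r" using u by blast
    then have "u \<otimes> a = t \<otimes> a \<oplus> x \<otimes> (r \<otimes> a)"
      using x a sub(1) by (auto simp: l_distr m_assoc subset_iff)
    then show ?thesis using * a sub(4) by blast
  qed
  show "right_ideal R ?I"
    unfolding right_ideal_iff
    by (intro conjI ballI carr add mult) (use T' sub(2) in \<open>rule subsetD\<close>)
qed

lemma right_ideal_zero: "right_ideal R {\<zero>}"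
  unfolding right_ideal_iff by auto

lemma right_ideal_principal:
  assumes "x \<in> carrier R"
  shows "right_ideal R {x \<otimes> r | r. r \<in> carrier R}"
proof -
  have "{t \<oplus> x \<otimes> r | t r. t \<in> {\<zero>} \<and> r \<in> carrier R} = {x \<otimes> r | r. r \<in> carrier R}"
    using assms by force
  then show ?thesis using right_ideal_add_principal(1)[OF right_ideal_zero assms] by metis
qed

lemma right_ideal_finsum:
  assumes "finite A" "right_ideal R T" "\<And>x. x \<in> A \<Longrightarrow> f x \<in> T"
  shows "(\<Oplus>x\<in>A. f x) \<in> T"
  using assms(1,3)
proof (induction A)
  case empty
  then show ?case using assms(2) unfolding right_ideal_iff by simp
next
  case (insert x A)
  have "T \<subseteq> carrier R" using assms(2) unfolding right_ideal_iff by blast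
  then have "f \<in> A \<rightarrow> carrier R" "f x \<in> carrier R" using insert.prems by auto
  then have "(\<Oplus>y\<in>insert x A. f y) = f x \<oplus> (\<Oplus>y\<in>A. f y)"
    using insert.hyps by (simp add: finsum_insert)
  then show ?case using insert assms(2) unfolding right_ideal_iff by auto
qed

lemma r_distr_minus:
  "\<lbrakk>x \<in> carrier R; y \<in> carrier R; z \<in> carrier R\<rbrakk> \<Longrightarrow> z \<otimes> (x \<ominus> y) = z \<otimes> x \<ominus> z \<otimes> y"
  by (simp add: minus_eq r_distr r_minus)

lemma l_distr_minus:
  "\<lbrakk>x \<in> carrier R; y \<in> carrier R; z \<in> carrier R\<rbrakk> \<Longrightarrow> (x \<ominus> y) \<otimes> z = x \<otimes> z \<ominus> y \<otimes> z"
  by (simp add: minus_eq l_distr l_minus)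

text \<open>
  Simplicity of the right ideal \<open>kR\<close>, phrased on elements: \<open>k\<close> can be recovered from each of its
  nonzero multiples. In this form simplicity passes to multiples of \<open>k\<close> by plain computation.
\<close>

definition minimal_generator :: "'a \<Rightarrow> bool" where
  "minimal_generator k \<longleftrightarrow> k \<in> carrier R \<and> k \<noteq> \<zero> \<and>
     (\<forall>r\<in>carrier R. k \<otimes> r \<noteq> \<zero> \<longrightarrow> (\<exists>s\<in>carrier R. k \<otimes> r \<otimes> s = k))"

lemma minimal_generator_carrier [simp]: "minimal_generator k \<Longrightarrow> k \<in> carrier R"
  by (simp add: minimal_generator_def)

lemma minimal_generatorE:
  assumes "minimal_generator k" "r \<in> carrier R" "k \<otimes> r \<noteq> \<zero>"
  obtains s where "s \<in> carrier R" "k \<otimes> r \<otimes> s = k"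
  using assms unfolding minimal_generator_def by blast

lemma minimal_generator_of_minimal_right_ideal:
  assumes "minimal_right_ideal R K" "x \<in> K" "x \<noteq> \<zero>"
  shows "minimal_generator x"
proof -
  let ?K = "(regular_right_module R)\<lparr>carrier := K\<rparr>"
  have K: "right_ideal R K" and simple: "\<And>N. right_submodule R N ?K \<Longrightarrow> N = {\<zero>} \<or> N = K"
    and M: "right_module R ?K"
    using assms(1) unfolding minimal_right_ideal_def simple_right_module_def
    by (auto simp: regular_right_module_def)
  have x: "x \<in> carrier R" using K assms(2) unfolding right_ideal_iff by blast
  have "\<exists>s\<in>carrier R. x \<otimes> r \<otimes> s = x" if r: "r \<in> carrier R" "x \<otimes> r \<noteq> \<zero>" for r
  proof -
    let ?N = "{x \<otimes> r \<otimes> s | s. s \<in> carrier R}"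
    have N: "right_ideal R ?N" using right_ideal_principal x r by simp
    have xr: "x \<otimes> r \<in> K" using K assms(2) r unfolding right_ideal_iff by blast
    then have "?N \<subseteq> K" using K unfolding right_ideal_iff by blast
    then have "right_submodule R ?N ?K"
      using N unfolding right_ideal_iff right_module.right_submodule_iff[OF M]
      by (simp add: regular_right_module_def)
    moreover have "x \<otimes> r \<otimes> \<one> \<in> ?N" by blast
    then have "?N \<noteq> {\<zero>}" using r x by auto
    ultimately have "x \<in> ?N" using simple assms(2) by blast
    then obtain s where "s \<in> carrier R" "x = x \<otimes> r \<otimes> s" by blast
    then show ?thesis by (intro bexI[of _ s]) simp_all
  qed
  then show ?thesis using x assms(3) unfolding minimal_generator_def by blast
qed

lemma simple_right_module_of_minimal_generator:
  assumes k: "minimal_generator k"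
  shows "simple_right_module R
    ((regular_right_module R)\<lparr>carrier := {k \<otimes> r | r. r \<in> carrier R}\<rparr>)"
    (is "simple_right_module R ?K")
proof -
  let ?C = "{k \<otimes> r | r. r \<in> carrier R}"
  have kR: "k \<in> carrier R" "k \<noteq> \<zero>" using k unfolding minimal_generator_def by auto
  have M: "right_module R ?K"
    using right_module.right_module_restrict[OF right_module_regular] right_ideal_principal kR
    by blast
  have "k \<otimes> \<one> \<in> ?C" by blast
  then have kC: "k \<in> ?C" using kR by simp
  have "N = {\<zero>} \<or> N = ?C" if N: "right_submodule R N ?K" for N
  proof (cases "N = {\<zero>}")
    case False
    have N': "N \<subseteq> ?C" "\<zero> \<in> N" "\<And>x a. x \<in> N \<Longrightarrow> a \<in> carrier R \<Longrightarrow> x \<otimes> a \<in> N"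
      using N unfolding right_module.right_submodule_iff[OF M]
      by (auto simp: regular_right_module_def)
    then obtain r where r: "r \<in> carrier R" "k \<otimes> r \<in> N" "k \<otimes> r \<noteq> \<zero>" using False by blast
    obtain s where "s \<in> carrier R" "k \<otimes> r \<otimes> s = k"
      using minimal_generatorE[OF k r(1,3)] .
    then have "k \<in> N" using N'(3)[OF r(2), of s] by simp
    then show ?thesis using N' by blast
  qed simp
  then show ?thesis
    unfolding simple_right_module_def using M kC kR by (auto simp: regular_right_module_def)
qed

text \<open>
  Left multiplication by \<open>a\<close> is a homomorphism from the simple module \<open>kR\<close>, so its image is simple or zero.
\<close>

lemma minimal_generator_left_mult:
  assumes k: "minimal_generator k" and a: "a \<in> carrier R" and "a \<otimes> k \<noteq> \<zero>"
  shows "minimal_generator (a \<otimes> k)"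
proof -
  have kR: "k \<in> carrier R" using k by simp
  have "\<exists>s\<in>carrier R. a \<otimes> k \<otimes> r \<otimes> s = a \<otimes> k"
    if r: "r \<in> carrier R" "a \<otimes> k \<otimes> r \<noteq> \<zero>" for r
  proof -
    have "k \<otimes> r \<noteq> \<zero>" using r(2) m_assoc[OF a kR r(1)] a by auto
    then obtain s where s: "s \<in> carrier R" "k \<otimes> r \<otimes> s = k"
      by (rule minimal_generatorE[OF k r(1)])
    then have "a \<otimes> k \<otimes> r \<otimes> s = a \<otimes> k" using r(1) a kR by (simp add: m_assoc)
    then show ?thesis using s(1) by blast
  qed
  then show ?thesis using assms kR unfolding minimal_generator_def[of "a \<otimes> k"] by simp
qed

lemma minimal_generator_right_mult:
  assumes k: "minimal_generator k" and a: "a \<in> carrier R" and "k \<otimes> a \<noteq> \<zero>"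
  shows "minimal_generator (k \<otimes> a)"
proof -
  have kR: "k \<in> carrier R" using k by simp
  have "\<exists>s\<in>carrier R. k \<otimes> a \<otimes> r \<otimes> s = k \<otimes> a"
    if r: "r \<in> carrier R" "k \<otimes> a \<otimes> r \<noteq> \<zero>" for r
  proof -
    have "k \<otimes> (a \<otimes> r) \<noteq> \<zero>" using r(2) m_assoc[OF kR a r(1)] by simp
    then obtain s where s: "s \<in> carrier R" "k \<otimes> (a \<otimes> r) \<otimes> s = k"
      using a r(1) by (elim minimal_generatorE[OF k, rotated]) auto
    have "k \<otimes> a \<otimes> r \<otimes> (s \<otimes> a) = k \<otimes> (a \<otimes> r) \<otimes> s \<otimes> a"
      using r(1) a kR s(1) by (simp add: m_assoc)
    also have "\<dots> = k \<otimes> a" using s(2) by simp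
    finally show ?thesis using s(1) a by (intro bexI[of _ "s \<otimes> a"]) auto
  qed
  then show ?thesis using assms kR unfolding minimal_generator_def[of "k \<otimes> a"] by simp
qed

text \<open>
  The left annihilator \<open>J\<close> of the right socle, tested on the elements that generate the socle. It will
  turn out to be nilpotent with semisimple quotient.
\<close>

definition socle_annihilator :: "'a set" where
  "socle_annihilator = {a \<in> carrier R. \<forall>k. minimal_generator k \<longrightarrow> a \<otimes> k = \<zero>}"

lemma socle_annihilator_carrier: "socle_annihilator \<subseteq> carrier R"
  by (auto simp: socle_annihilator_def)

lemma socle_annihilatorD:
  "a \<in> socle_annihilator \<Longrightarrow> minimal_generator k \<Longrightarrow> a \<otimes> k = \<zero>"
  by (auto simp: socle_annihilator_def)

lemma socle_annihilator_kills_translate: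
  assumes "a \<in> socle_annihilator" "minimal_generator k" "r \<in> carrier R"
  shows "a \<otimes> (r \<otimes> k) = \<zero>"
  using assms minimal_generator_left_mult[of k r] socle_annihilatorD[of a] socle_annihilator_carrier
  by (cases "r \<otimes> k = \<zero>") auto

lemma socle_annihilator_right_ideal: "right_ideal R socle_annihilator"
proof -
  have "a \<otimes> r \<in> socle_annihilator" if "a \<in> socle_annihilator" "r \<in> carrier R" for a r
  proof -
    have "a \<otimes> r \<otimes> k = \<zero>" if "minimal_generator k" for k
      using that \<open>a \<in> _\<close> \<open>r \<in> _\<close> socle_annihilator_kills_translate[of a k r]
        socle_annihilator_carrier by (auto simp: m_assoc subset_iff)
    then show ?thesis using that socle_annihilator_carrier by (auto simp: socle_annihilator_def)
  qed
  then show ?thesis unfolding right_ideal_iff by (auto simp: socle_annihilator_def l_distr)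
qed

lemma socle_annihilator_left_mult:
  "a \<in> socle_annihilator \<Longrightarrow> r \<in> carrier R \<Longrightarrow> r \<otimes> a \<in> socle_annihilator"
  by (auto simp: socle_annihilator_def m_assoc)

lemma right_annihilator_left_mult_mono:
  assumes "a \<in> carrier R" "b \<in> carrier R"
  shows "right_annihilator R {a} \<subseteq> right_annihilator R {b \<otimes> a}"
  using assms by (auto simp: right_annihilator_def m_assoc)

end

lemma ascending_chain_conditionD:
  assumes acc: "ascending_chain_condition \<S>"
    and "\<And>n. I n \<in> \<S>" "\<And>n. I n \<subseteq> I (Suc n)"
  shows "\<exists>m. \<forall>n\<ge>m. I n = I m"
  using acc[unfolded ascending_chain_condition_def, THEN spec, of I] assms(2,3) by simp

lemma ascending_chain_condition_maximal:
  assumes acc: "ascending_chain_condition \<S>" and "\<F> \<subseteq> \<S>" "\<F> \<noteq> {}"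
  obtains A where "A \<in> \<F>" "\<And>B. B \<in> \<F> \<Longrightarrow> A \<subseteq> B \<Longrightarrow> B = A"
proof -
  have "\<exists>A\<in>\<F>. \<forall>B\<in>\<F>. A \<subseteq> B \<longrightarrow> B = A"
  proof (rule ccontr)
    assume "\<not> ?thesis"
    then have "\<exists>B. B \<in> \<F> \<and> A \<subset> B" if "A \<in> \<F>" for A using that by blast
    then have "\<exists>I. \<forall>n::nat. I n \<in> \<F> \<and> I n \<subset> I (Suc n)"
      using \<open>\<F> \<noteq> {}\<close> by (intro dependent_nat_choice) auto
    then obtain I where I: "\<And>n::nat. I n \<in> \<F>" "\<And>n. I n \<subset> I (Suc n)" by blast
    have "\<exists>m. \<forall>n\<ge>m. I n = I m"
      by (rule ascending_chain_conditionD[OF acc]) (use I \<open>\<F> \<subseteq> \<S>\<close> in auto)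
    then obtain m where m: "\<forall>n\<ge>m. I n = I m" ..
    have "I (Suc m) = I m" by (rule m[rule_format]) simp
    then show False using I(2)[of m] by simp
  qed
  then show ?thesis using that by blast
qed

section \<open>Consequences of simple injectivity\<close>

locale right_simple_injective_ring = ring +
  assumes right_simple_injective: "right_simple_injective R"
begin

text \<open>
  The assignment \<open>t + x r \<mapsto> c r\<close> is a well-defined homomorphism on \<open>T + xR\<close> with image \<open>cR\<close>, which is zero
  or simple; so it is given by left multiplication. This is the only form in which simple injectivity is
  used.
\<close>

lemma simple_extension:
  assumes T: "right_ideal R T" and x: "x \<in> carrier R" and c: "c = \<zero> \<or> minimal_generator c"
    and wd: "\<And>r. r \<in> carrier R \<Longrightarrow> x \<otimes> r \<in> T \<Longrightarrow> c \<otimes> r = \<zero>"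
  obtains b where "b \<in> carrier R" "\<And>t. t \<in> T \<Longrightarrow> b \<otimes> t = \<zero>" "b \<otimes> x = c"
proof (cases "c = \<zero>")
  case True
  have "T \<subseteq> carrier R" using T unfolding right_ideal_iff by blast
  then show ?thesis using that[of \<zero>] x True by (auto simp: subset_iff)
next
  case False
  then have c: "minimal_generator c" using c by blast
  have cR: "c \<in> carrier R" using c by simp
  have TR: "T \<subseteq> carrier R" and T0: "\<zero> \<in> T" using T unfolding right_ideal_iff by auto
  define I where "I = {t \<oplus> x \<otimes> r | t r. t \<in> T \<and> r \<in> carrier R}"
  define f where "f u = (THE v. \<exists>t r. t \<in> T \<and> r \<in> carrier R \<and> u = t \<oplus> x \<otimes> r \<and> v = c \<otimes> r)" for u
  have f: "f (t \<oplus> x \<otimes> r) = c \<otimes> r" if t: "t \<in> T" and r: "r \<in> carrier R" for t r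
    unfolding f_def
  proof (rule the_equality)
    show "\<exists>t' r'. t' \<in> T \<and> r' \<in> carrier R \<and> t \<oplus> x \<otimes> r = t' \<oplus> x \<otimes> r' \<and> c \<otimes> r = c \<otimes> r'"
      using t r by blast
  next
    fix v assume "\<exists>t' r'. t' \<in> T \<and> r' \<in> carrier R \<and> t \<oplus> x \<otimes> r = t' \<oplus> x \<otimes> r' \<and> v = c \<otimes> r'"
    then obtain t' r' where *: "t' \<in> T" "r' \<in> carrier R" "t \<oplus> x \<otimes> r = t' \<oplus> x \<otimes> r'" "v = c \<otimes> r'"
      by blast
    have tR: "t \<in> carrier R" "t' \<in> carrier R" using TR t * by auto
    have "x \<otimes> (r' \<ominus> r) \<oplus> (t' \<oplus> x \<otimes> r) = t' \<oplus> x \<otimes> r'"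
      using x r *(2) tR by (simp add: minus_eq r_distr r_minus a_ac r_neg r_neg1)
    also have "\<dots> = t \<oplus> x \<otimes> r" using *(3) by simp
    also have "\<dots> = (t \<ominus> t') \<oplus> (t' \<oplus> x \<otimes> r)"
      using x r tR by (simp add: minus_eq a_assoc r_neg1)
    finally have "x \<otimes> (r' \<ominus> r) = t \<ominus> t'"
      using x r *(2) tR by simp
    then have "x \<otimes> (r' \<ominus> r) \<in> T" using right_ideal_minus[OF T t *(1)] by simp
    then have "c \<otimes> (r' \<ominus> r) = \<zero>" using wd r * by simp
    then have "c \<otimes> r' \<ominus> c \<otimes> r = \<zero>" using cR r * by (simp add: minus_eq r_distr r_minus)
    then show "v = c \<otimes> r" using *(2,4) cR r by (simp add: r_right_minus_eq)
  qed
  have I: "right_ideal R I" "T \<subseteq> I" "x \<in> I"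
    unfolding I_def using right_ideal_add_principal[OF T x] by auto
  have IR: "I \<subseteq> carrier R" using I(1) unfolding right_ideal_iff by blast
  have image: "f ` I = {c \<otimes> r | r. r \<in> carrier R}"
    unfolding I_def using T0 by (auto simp: f image_iff) (metis f)
  have add: "f (u \<oplus> v) = f u \<oplus> f v" if uv: "u \<in> I" "v \<in> I" for u v
  proof -
    obtain s q t r where *: "s \<in> T" "t \<in> T" "q \<in> carrier R" "r \<in> carrier R"
      "u = s \<oplus> x \<otimes> q" "v = t \<oplus> x \<otimes> r" using uv unfolding I_def by blast
    have stR: "s \<in> carrier R" "t \<in> carrier R" "s \<oplus> t \<in> T"
      using * TR T unfolding right_ideal_iff by auto
    then have "u \<oplus> v = (s \<oplus> t) \<oplus> x \<otimes> (q \<oplus> r)" using * x by (simp add: r_distr a_ac)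
    then show ?thesis using * stR f cR by (simp add: r_distr)
  qed
  have mult: "f (u \<otimes> a) = f u \<otimes> a" if u: "u \<in> I" and a: "a \<in> carrier R" for u a
  proof -
    obtain t r where *: "t \<in> T" "r \<in> carrier R" "u = t \<oplus> x \<otimes> r"
      using u unfolding I_def by blast
    have tR: "t \<in> carrier R" "t \<otimes> a \<in> T" using * TR T a unfolding right_ideal_iff by auto
    then have "u \<otimes> a = t \<otimes> a \<oplus> x \<otimes> (r \<otimes> a)" using * x a by (simp add: l_distr m_assoc)
    then show ?thesis using * tR f cR a by (simp add: m_assoc)
  qed
  have "f ` I \<subseteq> carrier R" using image cR by auto
  then have "f \<in> right_module_hom R ((regular_right_module R)\<lparr>carrier := I\<rparr>) (regular_right_module R)"
    unfolding right_module_hom_def regular_right_module_def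
    using add mult by (auto simp: image_subset_iff)
  moreover have "simple_right_module R ((regular_right_module R)\<lparr>carrier := f ` I\<rparr>)"
    using simple_right_module_of_minimal_generator[OF c] image by simp
  ultimately have "\<exists>b\<in>carrier R. \<forall>u\<in>I. f u = b \<otimes> u"
    using I(1)
      right_simple_injective[unfolded right_simple_injective_def, THEN spec, of I, THEN spec, of f]
    by simp
  then obtain b where b: "b \<in> carrier R" "\<And>u. u \<in> I \<Longrightarrow> f u = b \<otimes> u" by blast
  show ?thesis
  proof (rule that[OF b(1)])
    show "b \<otimes> t = \<zero>" if "t \<in> T" for t
      using b(2)[of t] f[OF that, of \<zero>] that I(2) TR x cR by (auto simp: subset_iff)
    show "b \<otimes> x = c"
      using b(2)[of x] f[OF T0, of \<one>] I(3) x cR by simp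
  qed
qed

lemma mininjective:
  assumes "minimal_generator k" "minimal_generator k'"
    and "\<And>r. r \<in> carrier R \<Longrightarrow> k \<otimes> r = \<zero> \<Longrightarrow> k' \<otimes> r = \<zero>"
  obtains b where "b \<in> carrier R" "b \<otimes> k = k'"
proof -
  have "k' \<otimes> r = \<zero>" if "r \<in> carrier R" "k \<otimes> r \<in> {\<zero>}" for r
    using assms(3) that by simp
  then show ?thesis
    using simple_extension[OF right_ideal_zero, of k k'] assms(1,2) that
    by (metis minimal_generator_carrier)
qed

text \<open>
  The generators \<open>k\<close> and \<open>a k\<close> have the same right annihilator, so each is a left multiple of the other.
  In other words, \<open>Rk\<close> is a simple left module.
\<close>

lemma minimal_generator_left_simple:
  assumes k: "minimal_generator k" and a: "a \<in> carrier R" and nz: "a \<otimes> k \<noteq> \<zero>"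
  obtains b where "b \<in> carrier R" "b \<otimes> (a \<otimes> k) = k"
proof -
  have "k \<otimes> r = \<zero>" if r: "r \<in> carrier R" "a \<otimes> k \<otimes> r = \<zero>" for r
  proof (rule ccontr)
    assume "k \<otimes> r \<noteq> \<zero>"
    then obtain s where s: "s \<in> carrier R" "k \<otimes> r \<otimes> s = k"
      by (rule minimal_generatorE[OF k r(1)])
    then have "a \<otimes> k = a \<otimes> (k \<otimes> r \<otimes> s)" by simp
    also have "\<dots> = a \<otimes> k \<otimes> r \<otimes> s" using k a r(1) s(1) by (simp add: m_assoc)
    also have "\<dots> = \<zero>" using r(2) s(1) by simp
    finally show False using nz by simp
  qed
  then show ?thesis
    using that mininjective[OF minimal_generator_left_mult[OF k a nz] k] by blast
qed

end

section \<open>The annihilator of the socle is nilpotent\<close>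

locale right_simple_injective_acc_ring = right_simple_injective_ring +
  assumes acc: "acc_right_annihilators R"
    and essential: "essential_right_submodule R (right_socle R) (regular_right_module R)"
begin

lemma socle_annihilator_kills_socle:
  assumes a: "a \<in> socle_annihilator" and s: "s \<in> right_socle R"
  shows "a \<otimes> s = \<zero>"
proof -
  have aR: "a \<in> carrier R" using a socle_annihilator_carrier by auto
  obtain F f where F: "finite F" "\<And>K. K \<in> F \<Longrightarrow> minimal_right_ideal R K \<and> f K \<in> K"
    "s = (\<Oplus>K\<in>F. f K)"
    using s unfolding right_socle_def by blast
  have fR: "f \<in> F \<rightarrow> carrier R"
    using F(2) unfolding minimal_right_ideal_def right_ideal_iff by blast
  have "a \<otimes> f K = \<zero>" if "K \<in> F" for K
    using F(2)[OF that] minimal_generator_of_minimal_right_ideal[of K "f K"]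
      socle_annihilatorD[OF a] aR by (cases "f K = \<zero>") auto
  then have "(\<Oplus>K\<in>F. a \<otimes> f K) = (\<Oplus>K\<in>F. \<zero>)"
    by (intro add.finprod_cong') auto
  moreover have "a \<otimes> (\<Oplus>K\<in>F. f K) = (\<Oplus>K\<in>F. a \<otimes> f K)"
    using finsum_rdistr[OF F(1) aR fR] .
  ultimately show ?thesis using F(3) by (simp add: add.finprod_one_eqI)
qed

text \<open>
  The right annihilator of \<open>b\<close> contains the socle and therefore meets every nonzero principal right ideal.
\<close>

lemma socle_annihilator_singular:
  assumes b: "b \<in> socle_annihilator" and a: "a \<in> carrier R" "a \<noteq> \<zero>"
  obtains t where "t \<in> carrier R" "a \<otimes> t \<noteq> \<zero>" "b \<otimes> (a \<otimes> t) = \<zero>"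
proof -
  let ?K = "{a \<otimes> r | r. r \<in> carrier R}"
  have K: "right_ideal R ?K" using right_ideal_principal a by simp
  have "a \<otimes> \<one> \<in> ?K" by blast
  then have "?K \<noteq> {\<zero>}" using a by auto
  then have ne: "right_socle R \<inter> ?K \<noteq> {\<zero>}" and S: "right_ideal R (right_socle R)"
    using essential K unfolding essential_right_submodule_def
    by (auto simp: regular_right_module_def)
  have "\<zero> \<in> right_socle R" "\<zero> \<in> ?K" using S K unfolding right_ideal_iff by blast+
  then obtain s where "s \<in> right_socle R" "s \<in> ?K" "s \<noteq> \<zero>" using ne by blast
  then show ?thesis using that socle_annihilator_kills_socle[OF b] by blast
qed

text \<open>
  Products of \<open>n + 1\<close> elements of \<open>J\<close>, rather than the ideal power that they generate: an ideal power
  is zero as soon as these products are.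
\<close>

primrec ann_products :: "nat \<Rightarrow> 'a set" where
  "ann_products 0 = socle_annihilator"
| "ann_products (Suc n) = {p \<otimes> b | p b. p \<in> ann_products n \<and> b \<in> socle_annihilator}"

lemma ann_products_subset: "ann_products n \<subseteq> socle_annihilator"
proof (induction n)
  case (Suc n)
  have "p \<otimes> b \<in> socle_annihilator" if "p \<in> ann_products n" "b \<in> socle_annihilator" for p b
    using that Suc socle_annihilator_right_ideal socle_annihilator_carrier
    unfolding right_ideal_iff by blast
  then show ?case by auto
qed simp

lemma ann_products_antimono: "ann_products (Suc n) \<subseteq> ann_products n"
proof (induction n)
  case 0
  show ?case using ann_products_subset[of "Suc 0"] by simp
next
  case (Suc n)
  then show ?case by fastforce
qed

text \<open>
  The argument for nilpotency of the right singular ideal. The right annihilators of the powers of \<open>J\<close>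
  increase, hence are constant from some \<open>m\<close> on. If the \<open>m\<close>-th one, \<open>A m\<close>, were not all of \<open>R\<close>, choose \<open>a\<close>
  outside of it with largest right annihilator. For \<open>b\<close> in \<open>J\<close> the right annihilator of \<open>b a\<close> is strictly
  larger than that of \<open>a\<close>, so \<open>b a\<close> lies in \<open>A m\<close>. Then \<open>a\<close> itself lies in \<open>A (m + 1) = A m\<close>, a
  contradiction.
\<close>

lemma socle_annihilator_nilpotent: "\<exists>n. ann_products n \<subseteq> {\<zero>}"
proof -
  define A where "A n = right_annihilator R (ann_products n)" for n
  have pR: "ann_products n \<subseteq> carrier R" for n
    using ann_products_subset socle_annihilator_carrier by blast
  have ann: "right_annihilator R X \<in> {right_annihilator R X | X. X \<subseteq> carrier R}"
    if "X \<subseteq> carrier R" for X using that by blast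
  have "A n \<subseteq> A (Suc n)" for n
    unfolding A_def right_annihilator_def using ann_products_antimono[of n] by blast
  moreover have "A n \<in> {right_annihilator R X | X. X \<subseteq> carrier R}" for n
    using ann[OF pR] A_def by simp
  ultimately have "\<exists>m. \<forall>n\<ge>m. A n = A m"
    by (intro ascending_chain_conditionD[OF acc[unfolded acc_right_annihilators_def]])
  then obtain m where m: "\<forall>n\<ge>m. A n = A m" ..
  have "carrier R \<subseteq> A m"
  proof (rule ccontr)
    assume "\<not> ?thesis"
    define F where "F = {right_annihilator R {a} | a. a \<in> carrier R \<and> a \<notin> A m}"
    have "F \<noteq> {}" "F \<subseteq> {right_annihilator R X | X. X \<subseteq> carrier R}"
      using \<open>\<not> _\<close> unfolding F_def by auto
    then obtain B where B: "B \<in> F" "\<And>C. C \<in> F \<Longrightarrow> B \<subseteq> C \<Longrightarrow> C = B"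
      using ascending_chain_condition_maximal[OF acc[unfolded acc_right_annihilators_def], of F]
      by metis
    then obtain a where a: "a \<in> carrier R" "a \<notin> A m" "B = right_annihilator R {a}"
      unfolding F_def by blast
    have "a \<noteq> \<zero>" using a pR[of m] unfolding A_def right_annihilator_def by (auto simp: subset_iff)
    have ba: "b \<otimes> a \<in> A m" if b: "b \<in> socle_annihilator" for b
    proof (rule ccontr)
      assume "b \<otimes> a \<notin> A m"
      have bR: "b \<in> carrier R" using b socle_annihilator_carrier by blast
      obtain t where t: "t \<in> carrier R" "a \<otimes> t \<noteq> \<zero>" "b \<otimes> (a \<otimes> t) = \<zero>"
        using socle_annihilator_singular[OF b a(1) \<open>a \<noteq> \<zero>\<close>] .
      have "right_annihilator R {b \<otimes> a} \<in> F"
        using \<open>b \<otimes> a \<notin> A m\<close> bR a unfolding F_def by auto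
      then have "right_annihilator R {b \<otimes> a} = B"
        using B(2) right_annihilator_left_mult_mono[OF a(1) bR] a(3) by simp
      moreover have "t \<in> right_annihilator R {b \<otimes> a}"
        using t(1,3) a(1) bR by (simp add: right_annihilator_def m_assoc)
      ultimately have "t \<in> right_annihilator R {a}" using a(3) by simp
      then show False using t(2) by (simp add: right_annihilator_def)
    qed
    have "p \<otimes> a = \<zero>" if p: "p \<in> ann_products (Suc m)" for p
    proof -
      obtain q b where "q \<in> ann_products m" "b \<in> socle_annihilator" "p = q \<otimes> b"
        using p by auto
      then show ?thesis
        using ba[of b] a(1) pR[of m] socle_annihilator_carrier
        by (auto simp: A_def right_annihilator_def m_assoc subset_iff)
    qed
    then have "a \<in> A (Suc m)" using a(1) by (simp add: A_def right_annihilator_def)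
    moreover have "A (Suc m) = A m" by (rule m[rule_format]) simp
    ultimately show False using a(2) by simp
  qed
  then have "\<one> \<in> A m" by blast
  then have "p \<otimes> \<one> = \<zero>" if "p \<in> ann_products m" for p
    using that by (simp add: A_def right_annihilator_def)
  then have "p = \<zero>" if "p \<in> ann_products m" for p
    using that pR[of m] by (metis r_one subsetD)
  then show ?thesis by blast
qed

text \<open>
  If every element of \<open>U\<close> outside \<open>T\<close> could be multiplied by an element of \<open>J\<close> so as to stay outside \<open>T\<close>,
  iterating from \<open>x\<close> would produce nonzero products of any number of elements of \<open>J\<close>. So a nonzero
  subquotient of \<open>R\<close> contains a nonzero element killed by \<open>J\<close>.
\<close>

lemma proper_mod_socle_annihilator:
  assumes T: "right_ideal R T" and x: "x \<in> carrier R" and nin: "x \<notin> T" "x \<in> U"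
    and U: "\<And>u a. u \<in> U \<Longrightarrow> a \<in> carrier R \<Longrightarrow> u \<otimes> a \<in> U" "U \<subseteq> carrier R"
  obtains z where "z \<in> U" "z \<notin> T" "\<And>j. j \<in> socle_annihilator \<Longrightarrow> z \<otimes> j \<in> T"
proof -
  have "\<exists>z\<in>U. z \<notin> T \<and> (\<forall>j\<in>socle_annihilator. z \<otimes> j \<in> T)"
  proof (rule ccontr)
    assume "\<not> ?thesis"
    then have step: "\<exists>j\<in>socle_annihilator. z \<otimes> j \<notin> T" if "z \<in> U" "z \<notin> T" for z
      using that by blast
    have JR: "socle_annihilator \<subseteq> carrier R" by (rule socle_annihilator_carrier)
    have "\<exists>p\<in>ann_products n. x \<otimes> p \<notin> T" for n
    proof (induction n)
      case 0
      then show ?case using step nin by simp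
    next
      case (Suc n)
      then obtain p where p: "p \<in> ann_products n" "x \<otimes> p \<notin> T" by blast
      then have pR: "p \<in> carrier R" using ann_products_subset JR by blast
      then obtain j where j: "j \<in> socle_annihilator" "x \<otimes> p \<otimes> j \<notin> T"
        using step p U nin by metis
      then have "x \<otimes> (p \<otimes> j) \<notin> T" using x pR JR by (auto simp: m_assoc subset_iff)
      then show ?case using p j by auto
    qed
    moreover obtain n where "ann_products n \<subseteq> {\<zero>}" using socle_annihilator_nilpotent by blast
    ultimately obtain p where "p = \<zero>" "x \<otimes> p \<notin> T" by blast
    then show False using T x unfolding right_ideal_iff by simp
  qed
  then show ?thesis using that by blast
qed

text \<open>
  Otherwise \<open>k = k j'\<close> with \<open>j'\<close> in \<open>J\<close>, and then \<open>k = k j' j' \<cdots> j' = 0\<close> by nilpotency. This is the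
  passage from left to right: by definition \<open>J\<close> kills the socle from the left.
\<close>

lemma minimal_generator_socle_annihilator:
  assumes k: "minimal_generator k" and j: "j \<in> socle_annihilator"
  shows "k \<otimes> j = \<zero>"
proof (rule ccontr)
  assume nz: "k \<otimes> j \<noteq> \<zero>"
  have kR: "k \<in> carrier R" "k \<noteq> \<zero>" and jR: "j \<in> carrier R"
    using k j socle_annihilator_carrier unfolding minimal_generator_def by auto
  obtain s where s: "s \<in> carrier R" "k \<otimes> j \<otimes> s = k" using minimal_generatorE[OF k jR nz] .
  have js: "j \<otimes> s \<in> socle_annihilator"
    using socle_annihilator_right_ideal j s unfolding right_ideal_iff by blast
  have "\<exists>p\<in>ann_products n. k \<otimes> p = k" for n
  proof (induction n)
    case 0
    then show ?case using js s kR jR by (auto simp: m_assoc[symmetric] intro: bexI[OF _ js])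
  next
    case (Suc n)
    then obtain p where p: "p \<in> ann_products n" "k \<otimes> p = k" by blast
    then have "p \<in> carrier R" using ann_products_subset socle_annihilator_carrier by blast
    then have "k \<otimes> (p \<otimes> (j \<otimes> s)) = k"
      using p s kR jR by (simp add: m_assoc[symmetric])
    then show ?case using p js by auto
  qed
  moreover obtain n where "ann_products n \<subseteq> {\<zero>}" using socle_annihilator_nilpotent by blast
  ultimately obtain p where "p = \<zero>" "k \<otimes> p = k" by blast
  then show False using kR by simp
qed

end

section \<open>A finite coordinate system modulo the annihilator of the socle\<close>

text \<open>
  Pigeonhole for a finite set with an equivalence relation \<open>E\<close>. The map \<open>f\<close> need not respect \<open>E\<close>, but it
  induces an injective map on a set of representatives, which is therefore onto.
\<close>

lemma finite_reflecting_self_map_surj: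
  assumes fin: "finite X" and f: "\<And>x. x \<in> X \<Longrightarrow> f x \<in> X"
    and refl: "\<And>x. x \<in> X \<Longrightarrow> E x x"
    and sym: "\<And>x y. x \<in> X \<Longrightarrow> y \<in> X \<Longrightarrow> E x y \<Longrightarrow> E y x"
    and trans: "\<And>x y z. x \<in> X \<Longrightarrow> y \<in> X \<Longrightarrow> z \<in> X \<Longrightarrow> E x y \<Longrightarrow> E y z \<Longrightarrow> E x z"
    and reflect: "\<And>x y. x \<in> X \<Longrightarrow> y \<in> X \<Longrightarrow> E (f x) (f y) \<Longrightarrow> E x y"
    and y: "y \<in> X"
  shows "\<exists>x\<in>X. E (f x) y"
proof -
  define rep where "rep x = (SOME z. z \<in> X \<and> E z x)" for x
  have rep: "rep x \<in> X" "E (rep x) x" if "x \<in> X" for x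
    using someI[of "\<lambda>z. z \<in> X \<and> E z x" x] that refl unfolding rep_def by auto
  have rep_cong: "rep x = rep z" if "x \<in> X" "z \<in> X" "E x z" for x z
  proof -
    have "(\<lambda>w. w \<in> X \<and> E w x) = (\<lambda>w. w \<in> X \<and> E w z)"
      using that sym trans by blast
    then show ?thesis unfolding rep_def by simp
  qed
  have rep_eq: "E x z" if "x \<in> X" "z \<in> X" "rep x = rep z" for x z
    using that rep[of x] rep[of z] sym[of "rep x" x] trans[of x "rep x" z] by simp
  have rep_rep: "rep (rep x) = rep x" if "x \<in> X" for x
    using rep_cong rep that by blast
  have "inj_on (\<lambda>b. rep (f b)) (rep ` X)"
  proof (rule inj_onI)
    fix b c assume b: "b \<in> rep ` X" and c: "c \<in> rep ` X" and eq: "rep (f b) = rep (f c)"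
    have bc: "b \<in> X" "c \<in> X" "rep b = b" "rep c = c" using b c rep rep_rep by auto
    then have "E b c" using reflect rep_eq eq f by blast
    then show "b = c" using rep_cong bc by metis
  qed
  moreover have "(\<lambda>b. rep (f b)) ` rep ` X \<subseteq> rep ` X" using f rep by auto
  ultimately have "(\<lambda>b. rep (f b)) ` rep ` X = rep ` X"
    using endo_inj_surj fin by (metis finite_imageI)
  then obtain b where "b \<in> rep ` X" "rep (f b) = rep y" using y by (metis imageE imageI)
  then have "b \<in> X" "E (f b) y" using rep rep_eq f y by auto
  then show ?thesis by blast
qed

context ring
begin

definition left_annihilator :: "'a set \<Rightarrow> 'a set" where
  "left_annihilator X = {a \<in> carrier R. \<forall>x\<in>X. a \<otimes> x = \<zero>}"

end

text \<open>
  A finite set \<open>X\<close> of generators of minimal right ideals with left annihilator \<open>J\<close>, with dual elements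
  \<open>e\<close>. Since \<open>J\<close> is tested on \<open>X\<close>, congruences modulo \<open>J\<close> become equations on \<open>X\<close>, and the conditions on
  \<open>e\<close> say that the \<open>e x\<close> are orthogonal idempotents modulo \<open>J\<close> with sum \<open>1\<close>.
\<close>

locale coordinate_system = right_simple_injective_acc_ring R
  for R :: "('a, 'b) ring_scheme" (structure) +
  fixes X :: "'a set" and e :: "'a \<Rightarrow> 'a"
  assumes finite_X: "finite X"
    and X_minimal: "x \<in> X \<Longrightarrow> minimal_generator x"
    and e_closed: "x \<in> X \<Longrightarrow> e x \<in> carrier R"
    and e_same: "x \<in> X \<Longrightarrow> e x \<otimes> x = x"
    and e_other: "x \<in> X \<Longrightarrow> y \<in> X \<Longrightarrow> y \<noteq> x \<Longrightarrow> e x \<otimes> y = \<zero>"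
    and socle_annihilatorI:
      "a \<in> carrier R \<Longrightarrow> (\<And>x. x \<in> X \<Longrightarrow> a \<otimes> x = \<zero>) \<Longrightarrow> a \<in> socle_annihilator"

text \<open>
  Among finite sets of generators of minimal right ideals choose \<open>X0\<close> for which the right annihilator of
  its left annihilator is maximal: adding one more generator changes nothing, so \<open>X0\<close> has left
  annihilator inside \<open>J\<close>. Now take such a set \<open>X\<close> of least size. Removing \<open>x\<close> leaves some \<open>a\<close> that kills the
  other members but not \<open>x\<close>, and since \<open>Rx\<close> is simple a left multiple of \<open>a\<close> fixes \<open>x\<close>.
\<close>

lemma (in right_simple_injective_acc_ring) coordinate_system_exists:
  "\<exists>X e. coordinate_system R X e"
proof -
  let ?G = "{k. minimal_generator k}"
  define F where "F = {right_annihilator R (left_annihilator X) | X. finite X \<and> X \<subseteq> ?G}"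
  have "left_annihilator X \<subseteq> carrier R" for X by (auto simp: left_annihilator_def)
  then have "F \<subseteq> {right_annihilator R X | X. X \<subseteq> carrier R}" unfolding F_def by blast
  moreover have "F \<noteq> {}" unfolding F_def by blast
  ultimately obtain A where A: "A \<in> F" "\<And>B. B \<in> F \<Longrightarrow> A \<subseteq> B \<Longrightarrow> B = A"
    using ascending_chain_condition_maximal[OF acc[unfolded acc_right_annihilators_def], of F]
    by metis
  then obtain X0 where X0: "finite X0" "X0 \<subseteq> ?G" "A = right_annihilator R (left_annihilator X0)"
    unfolding F_def by blast
  define P where "P X \<longleftrightarrow> finite X \<and> X \<subseteq> ?G \<and> left_annihilator X \<subseteq> socle_annihilator" for X
  have "P X0"
  proof -
    have "a \<otimes> k = \<zero>" if a: "a \<in> left_annihilator X0" and k: "minimal_generator k" for a k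
    proof -
      let ?B = "right_annihilator R (left_annihilator (insert k X0))"
      have "?B \<in> F" using X0 k unfolding F_def by blast
      moreover have "A \<subseteq> ?B"
        unfolding X0(3) by (auto simp: right_annihilator_def left_annihilator_def)
      ultimately have "?B = A" using A(2) by blast
      moreover have "k \<in> ?B" using k by (auto simp: right_annihilator_def left_annihilator_def)
      ultimately have "k \<in> right_annihilator R (left_annihilator X0)" using X0(3) by simp
      then show ?thesis using a by (simp add: right_annihilator_def)
    qed
    then show ?thesis
      using X0 unfolding P_def by (auto simp: socle_annihilator_def left_annihilator_def)
  qed
  then obtain X where X: "P X" "\<And>Y. P Y \<Longrightarrow> card X \<le> card Y"
    using ex_has_least_nat[of P X0 card] by blast
  have finX: "finite X" and XG: "\<And>x. x \<in> X \<Longrightarrow> minimal_generator x"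
    and LX: "left_annihilator X \<subseteq> socle_annihilator"
    using X(1) unfolding P_def by auto
  have "\<exists>c\<in>carrier R. c \<otimes> x = x \<and> (\<forall>y\<in>X - {x}. c \<otimes> y = \<zero>)" if x: "x \<in> X" for x
  proof -
    have "\<not> P (X - {x})"
      using X(2)[of "X - {x}"] finX x card_Diff1_less[OF finX x] by auto
    then obtain a where a: "a \<in> left_annihilator (X - {x})" "a \<notin> socle_annihilator"
      using X(1) unfolding P_def by blast
    have aR: "a \<in> carrier R" using a by (simp add: left_annihilator_def)
    have "a \<otimes> x \<noteq> \<zero>"
    proof
      assume "a \<otimes> x = \<zero>"
      then have "a \<in> left_annihilator X" using a by (auto simp: left_annihilator_def)
      then show False using LX a by blast
    qed
    then obtain b where b: "b \<in> carrier R" "b \<otimes> (a \<otimes> x) = x"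
      using minimal_generator_left_simple[OF XG[OF x] aR] by blast
    have "b \<otimes> a \<otimes> x = x" using b aR XG[OF x] by (simp add: m_assoc)
    moreover have "b \<otimes> a \<otimes> y = \<zero>" if "y \<in> X - {x}" for y
      using that a b(1) aR XG[of y] by (simp add: m_assoc left_annihilator_def)
    ultimately show ?thesis using aR b(1) by (intro bexI[of _ "b \<otimes> a"]) auto
  qed
  then obtain e where e: "\<And>x. x \<in> X \<Longrightarrow> e x \<in> carrier R \<and> e x \<otimes> x = x \<and> (\<forall>y\<in>X - {x}. e x \<otimes> y = \<zero>)"
    by metis
  have "coordinate_system R X e"
  proof
    show "a \<in> socle_annihilator" if "a \<in> carrier R" "\<And>x. x \<in> X \<Longrightarrow> a \<otimes> x = \<zero>" for a
      using that LX by (auto simp: left_annihilator_def)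
  qed (use finX XG e in auto)
  then show ?thesis by blast
qed

context coordinate_system
begin

lemma X_closed: "x \<in> X \<Longrightarrow> x \<in> carrier R"
  using X_minimal minimal_generator_carrier by blast

lemma X_nonzero: "x \<in> X \<Longrightarrow> x \<noteq> \<zero>"
  using X_minimal minimal_generator_def by blast

lemma cong_left_mult:
  assumes "minimal_generator k" "a \<in> carrier R" "b \<in> carrier R" "a \<ominus> b \<in> socle_annihilator"
  shows "k \<otimes> a = k \<otimes> b"
  using minimal_generator_socle_annihilator[OF assms(1,4)] assms(1-3)
  by (simp add: r_distr_minus)

lemma cong_right_mult:
  assumes "minimal_generator k" "a \<in> carrier R" "b \<in> carrier R" "a \<ominus> b \<in> socle_annihilator"
    and "r \<in> carrier R"
  shows "a \<otimes> (r \<otimes> k) = b \<otimes> (r \<otimes> k)"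
  using socle_annihilator_kills_translate[OF assms(4,1,5)] assms(1-3,5)
  by (simp add: l_distr_minus)

lemma congI:
  assumes "a \<in> carrier R" "b \<in> carrier R" "\<And>x. x \<in> X \<Longrightarrow> a \<otimes> x = b \<otimes> x"
  shows "a \<ominus> b \<in> socle_annihilator"
  using assms X_closed by (intro socle_annihilatorI) (auto simp: l_distr_minus)

text \<open>
  Because the sum of the \<open>e y\<close> is \<open>1\<close> modulo \<open>J\<close>, the element \<open>w\<close> is the sum of its components \<open>w e y\<close>
  modulo \<open>T\<close>.
\<close>

lemma residue_component:
  assumes T: "right_ideal R T" and w: "w \<in> carrier R" "w \<notin> T"
    and J: "\<And>j. j \<in> socle_annihilator \<Longrightarrow> w \<otimes> j \<in> T"
  obtains y where "y \<in> X" "w \<otimes> e y \<notin> T"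
proof -
  have "\<exists>y\<in>X. w \<otimes> e y \<notin> T"
  proof (rule ccontr)
    assume "\<not> ?thesis"
    then have in_T: "\<And>y. y \<in> X \<Longrightarrow> w \<otimes> e y \<in> T" by blast
    define s where "s = (\<Oplus>y\<in>X. e y)"
    have eX: "e \<in> X \<rightarrow> carrier R" using e_closed by auto
    then have sR: "s \<in> carrier R" unfolding s_def by simp
    have "s \<otimes> x = x" if x: "x \<in> X" for x
    proof -
      have "s \<otimes> x = (\<Oplus>y\<in>X. e y \<otimes> x)"
        unfolding s_def using finsum_ldistr[OF finite_X X_closed[OF x] eX] .
      also have "\<dots> = (\<Oplus>y\<in>X. if x = y then x else \<zero>)"
        using x X_closed e_same e_other by (intro add.finprod_cong') auto
      also have "\<dots> = x"
        using add.finprod_singleton[OF x finite_X, of "\<lambda>_. x"] X_closed[OF x] by auto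
      finally show ?thesis .
    qed
    then have "\<one> \<ominus> s \<in> socle_annihilator"
      using sR X_closed by (intro congI) auto
    then have "w \<otimes> (\<one> \<ominus> s) \<in> T" using J by blast
    moreover have "w \<otimes> s = (\<Oplus>y\<in>X. w \<otimes> e y)"
      unfolding s_def using finsum_rdistr[OF finite_X w(1) eX] .
    then have "w \<otimes> s \<in> T" using right_ideal_finsum[OF finite_X T] in_T by simp
    moreover have "w = w \<otimes> (\<one> \<ominus> s) \<oplus> w \<otimes> s"
    proof -
      have "w \<otimes> (\<one> \<ominus> s) = w \<ominus> w \<otimes> s" using w(1) sR by (simp add: r_distr_minus)
      then show ?thesis using w(1) sR by (simp add: minus_eq a_assoc l_neg)
    qed
    moreover have "\<And>u v. u \<in> T \<Longrightarrow> v \<in> T \<Longrightarrow> u \<oplus> v \<in> T"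
      using T unfolding right_ideal_iff by blast
    ultimately show False using w(2) by metis
  qed
  then show ?thesis using that by blast
qed

text \<open>
  The right ideal of \<open>R/J\<close> generated by \<open>e x\<close> is simple. The elements \<open>e\<close> come from
  simplicity of the left modules \<open>Ry\<close>, so this is where semisimplicity changes sides. Some \<open>y\<close> has \<open>e x r y \<noteq> 0\<close>, and an
  element \<open>b\<close> brings \<open>e x r y\<close> back to \<open>y\<close>; this left inverse is also a right inverse by Schur's lemma.
\<close>

lemma component_simple:
  assumes x: "x \<in> X" and r: "r \<in> carrier R" and nin: "e x \<otimes> r \<notin> socle_annihilator"
  obtains s where "s \<in> carrier R" "e x \<otimes> r \<otimes> s \<ominus> e x \<in> socle_annihilator"
proof -
  have ex: "e x \<in> carrier R" and xR: "x \<in> carrier R" using x e_closed X_closed by auto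
  obtain y where y: "y \<in> X" "e x \<otimes> r \<otimes> y \<noteq> \<zero>"
    using nin socle_annihilatorI[of "e x \<otimes> r"] ex r by auto
  have ey: "e y \<in> carrier R" and yR: "y \<in> carrier R" using y e_closed X_closed by auto
  obtain b where b: "b \<in> carrier R" "b \<otimes> (e x \<otimes> r \<otimes> y) = y"
    using minimal_generator_left_simple[OF X_minimal[OF y(1)] _ y(2)] ex r by auto
  define s where "s = e y \<otimes> (b \<otimes> e x)"
  have sR: "s \<in> carrier R" unfolding s_def using ey b ex by simp
  \<comment> \<open>The error of the candidate inverse \<open>s\<close>. It kills \<open>r y\<close>; if it did not kill \<open>x\<close>, a left
      multiple of it would agree with \<open>e x\<close> modulo \<open>J\<close>, and then \<open>e x r y\<close> would vanish.\<close>
  define d where "d = e x \<otimes> r \<otimes> s \<ominus> e x"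
  have dR: "d \<in> carrier R" unfolding d_def using ex r sR by simp
  have d_other: "d \<otimes> z = \<zero>" if z: "z \<in> X" "z \<noteq> x" for z
    using e_other[OF x z] X_closed[OF z(1)] ex ey r b(1)
    unfolding d_def s_def by (simp add: l_distr_minus m_assoc)
  have "d \<otimes> (r \<otimes> y) = e x \<otimes> r \<otimes> s \<otimes> (r \<otimes> y) \<ominus> e x \<otimes> (r \<otimes> y)"
    unfolding d_def using ex r sR yR by (simp add: l_distr_minus)
  also have "e x \<otimes> r \<otimes> s \<otimes> (r \<otimes> y) = e x \<otimes> r \<otimes> (e y \<otimes> (b \<otimes> (e x \<otimes> r \<otimes> y)))"
    unfolding s_def using ex ey r yR b(1) by (simp add: m_assoc)
  also have "\<dots> = e x \<otimes> (r \<otimes> y)" using b(2) e_same[OF y(1)] ex r yR by (simp add: m_assoc)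
  finally have d_ry: "d \<otimes> (r \<otimes> y) = \<zero>" using ex r yR by simp
  have "d \<otimes> x = \<zero>"
  proof (rule ccontr)
    assume "d \<otimes> x \<noteq> \<zero>"
    then obtain c where c: "c \<in> carrier R" "c \<otimes> (d \<otimes> x) = x"
      using minimal_generator_left_simple[OF X_minimal[OF x] dR] by blast
    have "c \<otimes> d \<otimes> z = e x \<otimes> z" if z: "z \<in> X" for z
    proof (cases "z = x")
      case True
      then show ?thesis using c dR xR e_same[OF x] by (simp add: m_assoc)
    next
      case False
      then show ?thesis
        using c(1) dR X_closed[OF z] d_other[OF z] e_other[OF x z] by (simp add: m_assoc)
    qed
    then have "c \<otimes> d \<ominus> e x \<in> socle_annihilator" using c(1) dR ex by (intro congI) auto
    then have "c \<otimes> d \<otimes> (r \<otimes> y) = e x \<otimes> (r \<otimes> y)"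
      using cong_right_mult[OF X_minimal[OF y(1)] _ ex _ r] c(1) dR by simp
    moreover have "c \<otimes> d \<otimes> (r \<otimes> y) = \<zero>" using c(1) dR r yR d_ry by (simp add: m_assoc)
    ultimately show False using y(2) ex r yR by (simp add: m_assoc)
  qed
  then have "d \<in> socle_annihilator"
    using d_other dR by (intro socle_annihilatorI) metis+
  then show ?thesis using that sR unfolding d_def by blast
qed

text \<open>
  Modulo \<open>J\<close> this says \<open>e x R e y \<noteq> 0\<close>, that is, \<open>x\<close> and \<open>y\<close> belong to the same block of the semisimple
  ring \<open>R/J\<close>.
\<close>

definition linked :: "'a \<Rightarrow> 'a \<Rightarrow> bool" where
  "linked x y \<longleftrightarrow> (\<exists>r\<in>carrier R. e x \<otimes> r \<otimes> y \<noteq> \<zero>)"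

lemma linked_refl: "x \<in> X \<Longrightarrow> linked x x"
  unfolding linked_def using e_closed e_same X_nonzero by (intro bexI[of _ \<one>]) auto

lemma linkedE:
  assumes "x \<in> X" "y \<in> X" "linked x y"
  obtains b r where "b \<in> carrier R" "r \<in> carrier R" "b \<otimes> (e x \<otimes> r \<otimes> y) = y"
proof -
  obtain r where r: "r \<in> carrier R" "e x \<otimes> r \<otimes> y \<noteq> \<zero>" using assms unfolding linked_def by blast
  then obtain b where "b \<in> carrier R" "b \<otimes> (e x \<otimes> r \<otimes> y) = y"
    using minimal_generator_left_simple[OF X_minimal[OF assms(2)], of "e x \<otimes> r"]
      e_closed[OF assms(1)] by auto
  then show ?thesis using that r by blast
qed

text \<open>
  With \<open>b e x r y = y\<close>, the element \<open>e y b e x\<close> does not lie in \<open>J\<close>, as it sends \<open>r y\<close> to \<open>y\<close>. Being zero on the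
  other members of \<open>X\<close>, it is nonzero on \<open>x\<close>.
\<close>

lemma linked_sym:
  assumes x: "x \<in> X" and y: "y \<in> X" and "linked x y"
  shows "linked y x"
proof (rule ccontr)
  assume not: "\<not> linked y x"
  obtain b r where br: "b \<in> carrier R" "r \<in> carrier R" "b \<otimes> (e x \<otimes> r \<otimes> y) = y"
    using linkedE[OF assms] .
  note R = e_closed[OF x] e_closed[OF y] X_closed[OF x] X_closed[OF y]
  have "e y \<otimes> (b \<otimes> e x) \<otimes> z = \<zero>" if z: "z \<in> X" for z
  proof (cases "z = x")
    case True
    then show ?thesis using not br(1) R e_same[OF x] unfolding linked_def by (simp add: m_assoc)
  next
    case False
    then show ?thesis using e_other[OF x z] X_closed[OF z] br(1) R by (simp add: m_assoc)
  qed
  then have "e y \<otimes> (b \<otimes> e x) \<in> socle_annihilator"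
    using br(1) R by (intro socle_annihilatorI) auto
  then have "e y \<otimes> (b \<otimes> e x) \<otimes> (r \<otimes> y) = \<zero>"
    using socle_annihilator_kills_translate X_minimal[OF y] br(2) by blast
  moreover have "e y \<otimes> (b \<otimes> e x) \<otimes> (r \<otimes> y) = e y \<otimes> (b \<otimes> (e x \<otimes> r \<otimes> y))"
    using br(1,2) R by (simp add: m_assoc)
  ultimately show False using br(3) e_same[OF y] X_nonzero[OF y] by simp
qed

text \<open>
  With \<open>b e x r y = y\<close>, the element \<open>b e x r e y\<close> agrees with \<open>e y\<close> modulo \<open>J\<close>, so any nonzero element
  \<open>e y s z\<close> factors through \<open>e x\<close>.
\<close>

lemma linked_trans:
  assumes x: "x \<in> X" and y: "y \<in> X" and z: "z \<in> X" and "linked x y" and "linked y z"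
  shows "linked x z"
proof -
  obtain b r where br: "b \<in> carrier R" "r \<in> carrier R" "b \<otimes> (e x \<otimes> r \<otimes> y) = y"
    using linkedE[OF x y \<open>linked x y\<close>] .
  obtain s where s: "s \<in> carrier R" "e y \<otimes> s \<otimes> z \<noteq> \<zero>"
    using \<open>linked y z\<close> unfolding linked_def by blast
  note R = e_closed[OF x] e_closed[OF y] X_closed[OF x] X_closed[OF y] X_closed[OF z]
  have "b \<otimes> (e x \<otimes> r \<otimes> e y) \<otimes> w = e y \<otimes> w" if w: "w \<in> X" for w
  proof (cases "w = y")
    case True
    then show ?thesis using br R e_same[OF y] by (simp add: m_assoc)
  next
    case False
    then show ?thesis using e_other[OF y w] X_closed[OF w] br(1,2) R by (simp add: m_assoc)
  qed
  then have "b \<otimes> (e x \<otimes> r \<otimes> e y) \<ominus> e y \<in> socle_annihilator"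
    using br R by (intro congI) auto
  then have "b \<otimes> (e x \<otimes> r \<otimes> e y) \<otimes> (s \<otimes> z) = e y \<otimes> (s \<otimes> z)"
    using cong_right_mult[OF X_minimal[OF z]] br R s(1) by simp
  then have "b \<otimes> (e x \<otimes> (r \<otimes> e y \<otimes> s) \<otimes> z) = e y \<otimes> s \<otimes> z"
    using br(1,2) R s(1) by (simp add: m_assoc)
  then have "e x \<otimes> (r \<otimes> e y \<otimes> s) \<otimes> z \<noteq> \<zero>" using s(2) br(1) by auto
  then show ?thesis unfolding linked_def using br(2) R s(1) by (intro bexI[of _ "r \<otimes> e y \<otimes> s"]) auto
qed

text \<open>
  For \<open>k = k e x\<close> the simple module \<open>kR\<close> is a quotient of the right ideal of \<open>R/J\<close> generated by \<open>e x\<close>, which is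
  itself simple. So the right annihilator of \<open>k\<close> depends on \<open>x\<close> alone: \<open>x\<close> names the isomorphism type of \<open>kR\<close>.
\<close>

lemma component_annihilator:
  assumes k: "minimal_generator k" and x: "x \<in> X" and ke: "k \<otimes> e x = k" and s: "s \<in> carrier R"
  shows "k \<otimes> s = \<zero> \<longleftrightarrow> e x \<otimes> s \<in> socle_annihilator"
proof
  note R = minimal_generator_carrier[OF k] e_closed[OF x]
  have ks: "k \<otimes> s = k \<otimes> (e x \<otimes> s)" using ke R s by (metis m_assoc)
  {
    assume "e x \<otimes> s \<in> socle_annihilator"
    then show "k \<otimes> s = \<zero>" using ks minimal_generator_socle_annihilator[OF k] by simp
  }
  assume 0: "k \<otimes> s = \<zero>"
  show "e x \<otimes> s \<in> socle_annihilator"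
  proof (rule ccontr)
    assume "e x \<otimes> s \<notin> socle_annihilator"
    then obtain t where t: "t \<in> carrier R" "e x \<otimes> s \<otimes> t \<ominus> e x \<in> socle_annihilator"
      using component_simple[OF x s] by blast
    have "k = k \<otimes> (e x \<otimes> s \<otimes> t)" using cong_left_mult[OF k _ _ t(2)] R s t(1) ke by simp
    also have "\<dots> = k \<otimes> (e x \<otimes> s) \<otimes> t" using R s t(1) by (simp add: m_assoc)
    also have "\<dots> = \<zero>" using 0 ks t(1) by simp
    finally show False using k unfolding minimal_generator_def by blast
  qed
qed

lemma component_generator:
  assumes k: "minimal_generator k" and x: "x \<in> X" and nz: "k \<otimes> e x \<noteq> \<zero>"
  shows "minimal_generator (k \<otimes> e x)" "k \<otimes> e x \<otimes> e x = k \<otimes> e x"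
proof -
  note R = minimal_generator_carrier[OF k] e_closed[OF x]
  show "minimal_generator (k \<otimes> e x)" by (rule minimal_generator_right_mult[OF k R(2) nz])
  have "e x \<otimes> e x \<otimes> z = e x \<otimes> z" if "z \<in> X" for z
    using e_same[OF x] e_other[OF x that] X_closed[OF that] R by (cases "z = x") (auto simp: m_assoc)
  then have "e x \<otimes> e x \<ominus> e x \<in> socle_annihilator" using R by (intro congI) auto
  then show "k \<otimes> e x \<otimes> e x = k \<otimes> e x" using cong_left_mult[OF k] R by (simp add: m_assoc)
qed

text \<open>
  Within one block all simple modules are isomorphic, so a minimal right ideal with a generator of type \<open>x\<close>
  also has a generator of type \<open>y\<close> when \<open>x\<close> and \<open>y\<close> are linked.
\<close>

lemma component_transport:
  assumes k: "minimal_generator k" and x: "x \<in> X" and ke: "k \<otimes> e x = k"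
    and y: "y \<in> X" and "linked x y"
  obtains r where "r \<in> carrier R" "minimal_generator (k \<otimes> r)" "k \<otimes> r \<otimes> e y = k \<otimes> r"
proof -
  obtain r where r: "r \<in> carrier R" "e x \<otimes> r \<otimes> y \<noteq> \<zero>"
    using \<open>linked x y\<close> unfolding linked_def by blast
  note R = minimal_generator_carrier[OF k] e_closed[OF x] e_closed[OF y] X_closed[OF y] r(1)
  have "e x \<otimes> (r \<otimes> e y) \<otimes> y \<noteq> \<zero>" using r(2) R e_same[OF y] by (simp add: m_assoc)
  then have "e x \<otimes> (r \<otimes> e y) \<notin> socle_annihilator"
    using socle_annihilatorD X_minimal[OF y] by blast
  then have "k \<otimes> (r \<otimes> e y) \<noteq> \<zero>" using component_annihilator[OF k x ke] R by simp
  then have nz: "k \<otimes> r \<otimes> e y \<noteq> \<zero>" using R by (simp add: m_assoc)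
  then have "k \<otimes> r \<noteq> \<zero>" using R by auto
  then have "minimal_generator (k \<otimes> r)" using minimal_generator_right_mult[OF k] R by simp
  then have "minimal_generator (k \<otimes> r \<otimes> e y)" "k \<otimes> r \<otimes> e y \<otimes> e y = k \<otimes> r \<otimes> e y"
    using component_generator[OF _ y nz] by auto
  then show ?thesis using that[of "r \<otimes> e y"] R by (simp add: m_assoc)
qed

lemma component_iso:
  assumes "minimal_generator k" "minimal_generator k'" "x \<in> X" "k \<otimes> e x = k" "k' \<otimes> e x = k'"
  obtains c where "c \<in> carrier R" "c \<otimes> k = k'"
  using mininjective[OF assms(1,2)] component_annihilator[OF _ assms(3)] assms by metis

text \<open>
  Every type of simple right module occurs in the socle. Send \<open>x\<close> to some \<open>f x\<close> with \<open>x e (f x) \<noteq> 0\<close>; thus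
  \<open>f x\<close> names the type of \<open>xR\<close>. If \<open>f x\<close> and \<open>f x'\<close> are linked, then \<open>xR\<close> and \<open>x'R\<close> are isomorphic, so
  \<open>x' \<in> R x R\<close> by simple injectivity. As \<open>e x'\<close> fixes \<open>x'\<close>, this gives \<open>e x' R x \<noteq> 0\<close>: the elements \<open>x\<close> and \<open>x'\<close>
  are linked. By the pigeonhole principle the values of \<open>f\<close> meet every block.
\<close>

lemma socle_component:
  assumes y: "y \<in> X"
  obtains k where "minimal_generator k" "k \<otimes> e y = k"
proof -
  have "\<exists>z\<in>X. x \<otimes> e z \<noteq> \<zero>" if x: "x \<in> X" for x
  proof -
    have "x \<otimes> j \<in> {\<zero>}" if "j \<in> socle_annihilator" for j
      using minimal_generator_socle_annihilator[OF X_minimal[OF x] that] by simp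
    then show ?thesis
      using residue_component[OF right_ideal_zero X_closed[OF x]] X_nonzero[OF x] by auto
  qed
  then obtain f where f: "\<And>x. x \<in> X \<Longrightarrow> f x \<in> X" "\<And>x. x \<in> X \<Longrightarrow> x \<otimes> e (f x) \<noteq> \<zero>"
    by metis
  note gen = component_generator[OF X_minimal f(1) f(2)]
  have reflect: "linked x x'" if x: "x \<in> X" and x': "x' \<in> X" and l: "linked (f x) (f x')" for x x'
  proof -
    let ?k = "x \<otimes> e (f x)" and ?k' = "x' \<otimes> e (f x')"
    obtain r where r: "r \<in> carrier R" "minimal_generator (?k \<otimes> r)"
      "?k \<otimes> r \<otimes> e (f x') = ?k \<otimes> r"
      using component_transport[OF gen(1)[OF x x x] f(1)[OF x] gen(2)[OF x x x] f(1)[OF x'] l] .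
    obtain c where c: "c \<in> carrier R" "c \<otimes> (?k \<otimes> r) = ?k'"
      using component_iso[OF r(2) gen(1)[OF x' x' x'] f(1)[OF x'] r(3) gen(2)[OF x' x' x']] .
    obtain d where d: "d \<in> carrier R" "?k' \<otimes> d = x'"
      using minimal_generatorE[OF X_minimal[OF x'] e_closed[OF f(1)[OF x']] f(2)[OF x']] .
    note R = X_closed[OF x] X_closed[OF x'] e_closed[OF x] e_closed[OF x'] e_closed[OF f(1)[OF x]]
      r(1) c(1) d(1)
    have "e x' \<otimes> c \<otimes> x \<otimes> (e (f x) \<otimes> r \<otimes> d) = e x' \<otimes> (c \<otimes> (?k \<otimes> r) \<otimes> d)"
      using R by (simp add: m_assoc)
    also have "\<dots> = x'" using c(2) d(2) e_same[OF x'] by simp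
    finally have "e x' \<otimes> c \<otimes> x \<noteq> \<zero>" using X_nonzero[OF x'] R by auto
    then have "linked x' x" unfolding linked_def using c(1) by blast
    then show ?thesis using linked_sym x x' by blast
  qed
  have "\<exists>x\<in>X. linked (f x) y"
    by (rule finite_reflecting_self_map_surj[where X = X and f = f and E = linked])
      (fact finite_X f(1) linked_refl linked_sym linked_trans reflect y)+
  then obtain x where x: "x \<in> X" "linked (f x) y" by blast
  obtain r where "minimal_generator (x \<otimes> e (f x) \<otimes> r)"
    "x \<otimes> e (f x) \<otimes> r \<otimes> e y = x \<otimes> e (f x) \<otimes> r"
    using component_transport[OF gen(1)[OF x(1) x(1) x(1)] f(1)[OF x(1)]
        gen(2)[OF x(1) x(1) x(1)] y x(2)] .
  then show ?thesis by (rule that)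
qed

text \<open>
  The simple module \<open>R/M\<close> embeds in \<open>R\<close> by sending the class of \<open>1\<close> to \<open>a\<close>. Some \<open>e y\<close> lies outside \<open>M\<close>, so \<open>R/M\<close>
  is of type \<open>y\<close>. If \<open>1\<close> agrees with \<open>e y t\<close> modulo \<open>M\<close> and \<open>k = k e y\<close> generates a minimal right ideal of the
  same type, then \<open>a = k t\<close> works. Maximality of \<open>M\<close> is phrased on elements: each \<open>r\<close> outside \<open>M\<close> is right
  invertible modulo \<open>M\<close>.
\<close>

lemma maximal_right_ideal_left_annihilated:
  assumes M: "right_ideal R M" and one: "\<one> \<notin> M"
    and max: "\<And>r. r \<in> carrier R \<Longrightarrow> r \<notin> M \<Longrightarrow> \<exists>s\<in>carrier R. \<one> \<ominus> r \<otimes> s \<in> M"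
  obtains a where "a \<in> carrier R" "a \<noteq> \<zero>" "\<And>m. m \<in> M \<Longrightarrow> a \<otimes> m = \<zero>"
proof -
  have MR: "M \<subseteq> carrier R" and M_add: "\<And>u v. u \<in> M \<Longrightarrow> v \<in> M \<Longrightarrow> u \<oplus> v \<in> M"
    and M_mult: "\<And>u a. u \<in> M \<Longrightarrow> a \<in> carrier R \<Longrightarrow> u \<otimes> a \<in> M"
    using M unfolding right_ideal_iff by auto
  have cancel: "v \<in> M" if "u \<ominus> v \<in> M" "u \<in> M" "v \<in> carrier R" for u v
  proof -
    have uR: "u \<in> carrier R" using that MR by blast
    have "u \<ominus> (u \<ominus> v) \<in> M" using right_ideal_minus[OF M that(2,1)] .
    moreover have "u \<ominus> (u \<ominus> v) = v"
      using uR that(3) by (simp add: minus_eq minus_add r_neg2)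
    ultimately show ?thesis by simp
  qed
  have cancel': "u \<in> M" if "u \<ominus> v \<in> M" "v \<in> M" "u \<in> carrier R" for u v
  proof -
    have "(u \<ominus> v) \<oplus> v \<in> M" using M_add that by blast
    moreover have "v \<in> carrier R" using that MR by blast
    ultimately show ?thesis using that(3) by (simp add: minus_eq a_assoc l_neg)
  qed
  \<comment> \<open>\<open>R/M\<close> is generated by an element \<open>z\<close> that \<open>J\<close> kills, so \<open>J\<close>, a two-sided ideal, kills all of it.\<close>
  have JM: "j \<in> M" if j: "j \<in> socle_annihilator" for j
  proof -
    have jR: "j \<in> carrier R" using j socle_annihilator_carrier by blast
    obtain z where z: "z \<in> carrier R" "z \<notin> M" "\<And>j. j \<in> socle_annihilator \<Longrightarrow> z \<otimes> j \<in> M"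
      using proper_mod_socle_annihilator[OF M one_closed one, of "carrier R"] by auto
    obtain s where s: "s \<in> carrier R" "\<one> \<ominus> z \<otimes> s \<in> M" using max[OF z(1,2)] by blast
    have "(\<one> \<ominus> z \<otimes> s) \<otimes> j = j \<ominus> z \<otimes> (s \<otimes> j)"
      using z(1) s(1) jR by (simp add: l_distr_minus m_assoc)
    then have "j \<ominus> z \<otimes> (s \<otimes> j) \<in> M" using M_mult[OF s(2) jR] by simp
    moreover have "z \<otimes> (s \<otimes> j) \<in> M" using z(3) socle_annihilator_left_mult[OF j s(1)] by blast
    ultimately show ?thesis using cancel' jR by blast
  qed
  have "\<one> \<otimes> j \<in> M" if "j \<in> socle_annihilator" for j
    using JM[OF that] socle_annihilator_carrier that by auto
  then obtain y where y: "y \<in> X" "\<one> \<otimes> e y \<notin> M"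
    using residue_component[OF M one_closed one] by blast
  have ey: "e y \<in> carrier R" "e y \<notin> M" using y e_closed by auto
  obtain t where t: "t \<in> carrier R" "\<one> \<ominus> e y \<otimes> t \<in> M" using max[OF ey] by blast
  obtain k where k: "minimal_generator k" "k \<otimes> e y = k" using socle_component[OF y(1)] .
  have kR: "k \<in> carrier R" using k by simp
  have "k \<otimes> t \<noteq> \<zero>"
  proof
    assume "k \<otimes> t = \<zero>"
    then have "e y \<otimes> t \<in> M" using component_annihilator[OF k(1) y(1) k(2) t(1)] JM by blast
    then show False using cancel'[OF t(2)] one by blast
  qed
  moreover have "k \<otimes> t \<otimes> m = \<zero>" if m: "m \<in> M" for m
  proof -
    have mR: "m \<in> carrier R" using m MR by blast
    have "(\<one> \<ominus> e y \<otimes> t) \<otimes> m = m \<ominus> e y \<otimes> (t \<otimes> m)"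
      using ey(1) t(1) mR by (simp add: l_distr_minus m_assoc)
    then have "m \<ominus> e y \<otimes> (t \<otimes> m) \<in> M" using M_mult[OF t(2) mR] by simp
    then have in_M: "e y \<otimes> (t \<otimes> m) \<in> M" using cancel m ey(1) t(1) mR by blast
    have "e y \<otimes> (t \<otimes> m) \<in> socle_annihilator"
    proof (rule ccontr)
      assume "e y \<otimes> (t \<otimes> m) \<notin> socle_annihilator"
      then obtain s where s: "s \<in> carrier R" "e y \<otimes> (t \<otimes> m) \<otimes> s \<ominus> e y \<in> socle_annihilator"
        using component_simple[OF y(1), of "t \<otimes> m"] t(1) mR by auto
      then show False using cancel[OF JM[OF s(2)] M_mult[OF in_M s(1)]] ey by blast
    qed
    then have "k \<otimes> (t \<otimes> m) = \<zero>"
      using component_annihilator[OF k(1) y(1) k(2)] t(1) mR by simp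
    then show ?thesis using kR t(1) mR by (simp add: m_assoc)
  qed
  ultimately show ?thesis using that[of "k \<otimes> t"] kR t(1) by simp
qed

text \<open>
  A nonzero subquotient \<open>(U + T)/T\<close> contains a nonzero element killed by \<open>J\<close>; one of the components of that
  element is nonzero, and it generates a copy of the simple module attached to some \<open>e y\<close>.
\<close>

lemma simple_subquotient:
  assumes T: "right_ideal R T" and U: "right_ideal R U" and "x \<in> U" "x \<notin> T"
  obtains z where "z \<in> U" "z \<notin> T"
    "\<And>r. r \<in> carrier R \<Longrightarrow> z \<otimes> r \<notin> T \<Longrightarrow> \<exists>s\<in>carrier R. z \<ominus> z \<otimes> r \<otimes> s \<in> T"
proof -
  have UR: "U \<subseteq> carrier R" and U_mult: "\<And>u a. u \<in> U \<Longrightarrow> a \<in> carrier R \<Longrightarrow> u \<otimes> a \<in> U"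
    using U unfolding right_ideal_iff by auto
  have T0: "\<zero> \<in> T" using T unfolding right_ideal_iff by blast
  have xR: "x \<in> carrier R" using UR assms(3) by blast
  obtain w where w: "w \<in> U" "w \<notin> T" "\<And>j. j \<in> socle_annihilator \<Longrightarrow> w \<otimes> j \<in> T"
    using proper_mod_socle_annihilator[OF T xR assms(4,3) U_mult UR] by blast
  have wR: "w \<in> carrier R" using w UR by blast
  obtain y where y: "y \<in> X" "w \<otimes> e y \<notin> T" using residue_component[OF T wR w(2,3)] by blast
  have ey: "e y \<in> carrier R" using y e_closed by blast
  have "\<exists>s\<in>carrier R. w \<otimes> e y \<ominus> w \<otimes> e y \<otimes> r \<otimes> s \<in> T"
    if r: "r \<in> carrier R" "w \<otimes> e y \<otimes> r \<notin> T" for r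
  proof -
    have "e y \<otimes> r \<notin> socle_annihilator"
      using w(3) r wR ey by (auto simp: m_assoc)
    then obtain s where s: "s \<in> carrier R" "e y \<otimes> r \<otimes> s \<ominus> e y \<in> socle_annihilator"
      using component_simple[OF y(1) r(1)] by blast
    then have "\<zero> \<ominus> w \<otimes> (e y \<otimes> r \<otimes> s \<ominus> e y) \<in> T"
      using right_ideal_minus[OF T T0 w(3)] by blast
    moreover have "\<zero> \<ominus> w \<otimes> (e y \<otimes> r \<otimes> s \<ominus> e y) = w \<otimes> e y \<ominus> w \<otimes> e y \<otimes> r \<otimes> s"
    proof -
      have "w \<otimes> (e y \<otimes> r \<otimes> s \<ominus> e y) = w \<otimes> e y \<otimes> r \<otimes> s \<ominus> w \<otimes> e y"
        using wR ey r(1) s(1) by (simp add: r_distr_minus m_assoc)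
      then show ?thesis using wR ey r(1) s(1) by (simp add: minus_eq minus_add a_comm)
    qed
    ultimately show ?thesis using s(1) by (intro bexI[of _ s]) simp_all
  qed
  then show ?thesis using that y(2) U_mult[OF w(1) ey] by blast
qed

end

section \<open>Right ideals are annihilators, and homomorphisms from them are multiplications\<close>

context right_simple_injective_acc_ring
begin

text \<open>
  Given \<open>x\<close> outside \<open>T\<close>, enlarge \<open>T\<close> to a right ideal \<open>U\<close> maximal with respect to not containing \<open>x\<close>. Then
  \<open>(U + xR)/U\<close> is simple and embeds in \<open>R\<close>. The resulting homomorphism on \<open>U + xR\<close> is left multiplication by some \<open>b\<close>,
  which kills \<open>T\<close> but not \<open>x\<close>.
\<close>

lemma right_ideal_is_right_annihilator:
  assumes T: "right_ideal R T"
  shows "right_annihilator R (left_annihilator T) = T"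
proof
  have TR: "T \<subseteq> carrier R" using T unfolding right_ideal_iff by blast
  then show "T \<subseteq> right_annihilator R (left_annihilator T)"
    by (auto simp: right_annihilator_def left_annihilator_def)
  show "right_annihilator R (left_annihilator T) \<subseteq> T"
  proof (rule ccontr)
    assume "\<not> ?thesis"
    then obtain x where x: "x \<in> right_annihilator R (left_annihilator T)" "x \<notin> T" by blast
    then have xR: "x \<in> carrier R" by (simp add: right_annihilator_def)
    define \<A> where "\<A> = {U. right_ideal R U \<and> T \<subseteq> U \<and> x \<notin> U}"
    have "\<exists>U\<in>\<A>. \<forall>V\<in>\<A>. U \<subseteq> V \<longrightarrow> V = U"
    proof (rule subset_Zorn_nonempty)
      show "\<A> \<noteq> {}" using T x unfolding \<A>_def by blast
    next
      fix \<C> assume \<C>: "\<C> \<noteq> {}" "subset.chain \<A> \<C>"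
      have in_A: "right_ideal R U" "T \<subseteq> U" "x \<notin> U" if "U \<in> \<C>" for U
        using \<C>(2) that unfolding \<A>_def subset.chain_def by auto
      have "right_ideal R (\<Union>\<C>)"
        unfolding right_ideal_iff
      proof (intro conjI ballI)
        show "\<Union>\<C> \<subseteq> carrier R" using in_A(1) unfolding right_ideal_iff by blast
        show "\<zero> \<in> \<Union>\<C>" using in_A(1) \<C>(1) unfolding right_ideal_iff by blast
      next
        fix u v assume "u \<in> \<Union>\<C>" "v \<in> \<Union>\<C>"
        then obtain U V where UV: "U \<in> \<C>" "V \<in> \<C>" "u \<in> U" "v \<in> V" by blast
        have "U \<subseteq> V \<or> V \<subseteq> U"
          using \<C>(2) UV(1,2) unfolding subset.chain_def by blast
        then obtain W where "W \<in> \<C>" "u \<in> W" "v \<in> W" using UV by blast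
        then show "u \<oplus> v \<in> \<Union>\<C>" using in_A(1) unfolding right_ideal_iff by blast
      next
        fix u a assume "u \<in> \<Union>\<C>" "a \<in> carrier R"
        then show "u \<otimes> a \<in> \<Union>\<C>" using in_A(1) unfolding right_ideal_iff by blast
      qed
      then show "\<Union>\<C> \<in> \<A>" using in_A(2,3) \<C>(1) unfolding \<A>_def by blast
    qed
    then obtain U where U: "U \<in> \<A>" "\<And>V. V \<in> \<A> \<Longrightarrow> U \<subseteq> V \<Longrightarrow> V = U" by blast
    have UI: "right_ideal R U" "T \<subseteq> U" "x \<notin> U" using U(1) unfolding \<A>_def by auto
    have UR: "U \<subseteq> carrier R" "\<zero> \<in> U" "\<And>u v. u \<in> U \<Longrightarrow> v \<in> U \<Longrightarrow> u \<oplus> v \<in> U"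
      "\<And>u a. u \<in> U \<Longrightarrow> a \<in> carrier R \<Longrightarrow> u \<otimes> a \<in> U"
      using UI(1) unfolding right_ideal_iff by auto
    \<comment> \<open>The maximal right ideal with \<open>R/M\<close> isomorphic to \<open>(U + xR)/U\<close>.\<close>
    define M where "M = {r \<in> carrier R. x \<otimes> r \<in> U}"
    have M: "right_ideal R M"
      unfolding right_ideal_iff M_def
      using xR UR by (auto simp: r_distr m_assoc[symmetric])
    have one: "\<one> \<notin> M" using xR UI(3) unfolding M_def by simp
    have max: "\<exists>s\<in>carrier R. \<one> \<ominus> r \<otimes> s \<in> M" if r: "r \<in> carrier R" "r \<notin> M" for r
    proof -
      let ?V = "{u \<oplus> x \<otimes> r \<otimes> s | u s. u \<in> U \<and> s \<in> carrier R}"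
      have xr: "x \<otimes> r \<in> carrier R" "x \<otimes> r \<notin> U" using r xR unfolding M_def by auto
      note V = right_ideal_add_principal[OF UI(1) xr(1)]
      have "?V \<noteq> U" using V(3) xr(2) by blast
      then have "?V \<notin> \<A>" using U(2) V(2) by blast
      then have "x \<in> ?V" using V(1,2) UI(2) unfolding \<A>_def by blast
      then obtain u s where us: "u \<in> U" "s \<in> carrier R" "x = u \<oplus> x \<otimes> r \<otimes> s" by blast
      have uR: "u \<in> carrier R" using us UR by blast
      have "x \<otimes> (\<one> \<ominus> r \<otimes> s) = x \<ominus> x \<otimes> r \<otimes> s"
        using xR r(1) us(2) by (simp add: r_distr_minus m_assoc)
      also have "\<dots> = (u \<oplus> x \<otimes> r \<otimes> s) \<ominus> x \<otimes> r \<otimes> s" using us(3) by simp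
      also have "\<dots> = u" using uR xr(1) us(2) by (simp add: minus_eq a_assoc r_neg)
      finally show ?thesis using us(1,2) r(1) unfolding M_def by (intro bexI[of _ s]) auto
    qed
    obtain X e where "coordinate_system R X e" using coordinate_system_exists by blast
    then interpret coordinate_system R X e .
    obtain a where a: "a \<in> carrier R" "a \<noteq> \<zero>" "\<And>m. m \<in> M \<Longrightarrow> a \<otimes> m = \<zero>"
      using maximal_right_ideal_left_annihilated[OF M one max] by blast
    have "\<exists>s\<in>carrier R. a \<otimes> r \<otimes> s = a" if r: "r \<in> carrier R" "a \<otimes> r \<noteq> \<zero>" for r
    proof -
      have "r \<notin> M" using a(3) r by blast
      then obtain s where s: "s \<in> carrier R" "\<one> \<ominus> r \<otimes> s \<in> M" using max r by blast
      then have "a \<ominus> a \<otimes> r \<otimes> s = \<zero>"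
        using a(3)[OF s(2)] a(1) r(1) by (simp add: r_distr_minus m_assoc)
      then show ?thesis using a(1) r(1) s(1) by (intro bexI[of _ s]) auto
    qed
    then have "minimal_generator a" using a unfolding minimal_generator_def by blast
    moreover have "a \<otimes> r = \<zero>" if "r \<in> carrier R" "x \<otimes> r \<in> U" for r
      using a(3)[of r] that unfolding M_def by blast
    ultimately obtain b where b: "b \<in> carrier R" "\<And>t. t \<in> U \<Longrightarrow> b \<otimes> t = \<zero>" "b \<otimes> x = a"
      using simple_extension[OF UI(1) xR] by blast
    then have "b \<in> left_annihilator T" using UI(2) by (auto simp: left_annihilator_def)
    then have "b \<otimes> x = \<zero>" using x(1) by (simp add: right_annihilator_def)
    then show False using a(2) b(3) by simp
  qed
qed

lemma right_noetherian: "right_noetherian R"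
proof -
  have "left_annihilator T \<subseteq> carrier R" for T by (auto simp: left_annihilator_def)
  then have sub: "{I. right_ideal R I} \<subseteq> {right_annihilator R X | X. X \<subseteq> carrier R}"
    using right_ideal_is_right_annihilator by blast
  show ?thesis
    unfolding right_noetherian_def ascending_chain_condition_def
  proof (intro allI impI)
    fix I :: "nat \<Rightarrow> 'a set"
    assume "(\<forall>n. I n \<in> {I. right_ideal R I}) \<and> (\<forall>n. I n \<subseteq> I (Suc n))"
    then show "\<exists>m. \<forall>n\<ge>m. I n = I m"
      using sub
      by (intro ascending_chain_conditionD[OF acc[unfolded acc_right_annihilators_def]]) blast+
  qed
qed

text \<open>
  On a largest right ideal \<open>U\<close> inside \<open>T\<close> on which \<open>f\<close> is multiplication by some \<open>a\<close>, the obstruction to going on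
  to \<open>U + zR\<close>, with \<open>z\<close> simple modulo \<open>U\<close>, is the element \<open>c = f z - a z\<close>. It is zero or generates a minimal right ideal, so
  it is removed by adding to \<open>a\<close> a multiplier \<open>b\<close> that kills \<open>U\<close>.
\<close>

lemma right_ideal_hom_is_left_mult:
  assumes T: "right_ideal R T" and f: "\<And>u. u \<in> T \<Longrightarrow> f u \<in> carrier R"
    and add: "\<And>u v. u \<in> T \<Longrightarrow> v \<in> T \<Longrightarrow> f (u \<oplus> v) = f u \<oplus> f v"
    and mult: "\<And>u a. u \<in> T \<Longrightarrow> a \<in> carrier R \<Longrightarrow> f (u \<otimes> a) = f u \<otimes> a"
  shows "\<exists>a\<in>carrier R. \<forall>u\<in>T. f u = a \<otimes> u"
proof -
  have TR: "T \<subseteq> carrier R" "\<zero> \<in> T" "\<And>u v. u \<in> T \<Longrightarrow> v \<in> T \<Longrightarrow> u \<oplus> v \<in> T"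
    "\<And>u a. u \<in> T \<Longrightarrow> a \<in> carrier R \<Longrightarrow> u \<otimes> a \<in> T"
    using T unfolding right_ideal_iff by auto
  define \<F> where "\<F> = {U. right_ideal R U \<and> U \<subseteq> T \<and> (\<exists>a\<in>carrier R. \<forall>u\<in>U. f u = a \<otimes> u)}"
  have "f \<zero> = \<zero> \<otimes> \<zero>" using mult[OF TR(2) zero_closed] f[OF TR(2)] by simp
  then have "{\<zero>} \<in> \<F>" unfolding \<F>_def using right_ideal_zero TR(2) by blast
  then have "\<F> \<noteq> {}" by blast
  moreover have "\<F> \<subseteq> {I. right_ideal R I}" unfolding \<F>_def by blast
  ultimately obtain U where U: "U \<in> \<F>" "\<And>V. V \<in> \<F> \<Longrightarrow> U \<subseteq> V \<Longrightarrow> V = U"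
    using ascending_chain_condition_maximal[OF right_noetherian[unfolded right_noetherian_def], of \<F>]
    by metis
  obtain a where UI: "right_ideal R U" "U \<subseteq> T" and a: "a \<in> carrier R" "\<And>u. u \<in> U \<Longrightarrow> f u = a \<otimes> u"
    using U(1) unfolding \<F>_def by blast
  have "T \<subseteq> U"
  proof (rule ccontr)
    assume "\<not> T \<subseteq> U"
    then obtain x where x: "x \<in> T" "x \<notin> U" by blast
    obtain X e where "coordinate_system R X e" using coordinate_system_exists by blast
    then interpret coordinate_system R X e .
    obtain z where z: "z \<in> T" "z \<notin> U"
      "\<And>r. r \<in> carrier R \<Longrightarrow> z \<otimes> r \<notin> U \<Longrightarrow> \<exists>s\<in>carrier R. z \<ominus> z \<otimes> r \<otimes> s \<in> U"
      using simple_subquotient[OF UI(1) T x] by blast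
    have zR: "z \<in> carrier R" and fz: "f z \<in> carrier R" using z(1) TR(1) f by auto
    define c where "c = f z \<ominus> a \<otimes> z"
    have cR: "c \<in> carrier R" unfolding c_def using fz a(1) zR by simp
    have c_mult: "c \<otimes> r = f (z \<otimes> r) \<ominus> a \<otimes> (z \<otimes> r)" if "r \<in> carrier R" for r
      unfolding c_def using that fz a(1) zR mult[OF z(1) that] by (simp add: l_distr_minus m_assoc)
    have c_zero: "c \<otimes> r = \<zero>" if r: "r \<in> carrier R" "z \<otimes> r \<in> U" for r
      using c_mult[OF r(1)] a(2)[OF r(2)] a(1) zR r(1) by simp
    have "minimal_generator c" if nz: "c \<noteq> \<zero>"
    proof -
      have "\<exists>s\<in>carrier R. c \<otimes> r \<otimes> s = c" if r: "r \<in> carrier R" "c \<otimes> r \<noteq> \<zero>" for r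
      proof -
        have "z \<otimes> r \<notin> U" using c_zero r by blast
        then obtain s where s: "s \<in> carrier R" "z \<ominus> z \<otimes> r \<otimes> s \<in> U" using z(3) r(1) by blast
        have "z \<ominus> z \<otimes> r \<otimes> s = z \<otimes> (\<one> \<ominus> r \<otimes> s)"
          using zR r(1) s(1) by (simp add: r_distr_minus m_assoc)
        then have "c \<otimes> (\<one> \<ominus> r \<otimes> s) = \<zero>" using c_zero s r(1) by simp
        then have "c \<ominus> c \<otimes> r \<otimes> s = \<zero>"
          using cR r(1) s(1) by (simp add: r_distr_minus m_assoc)
        then show ?thesis using cR r(1) s(1) by (intro bexI[of _ s]) auto
      qed
      then show ?thesis using cR nz unfolding minimal_generator_def by blast
    qed
    then obtain b where b: "b \<in> carrier R" "\<And>u. u \<in> U \<Longrightarrow> b \<otimes> u = \<zero>" "b \<otimes> z = c"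
      using simple_extension[OF UI(1) zR _ c_zero] by blast
    let ?V = "{u \<oplus> z \<otimes> r | u r. u \<in> U \<and> r \<in> carrier R}"
    note V = right_ideal_add_principal[OF UI(1) zR]
    have "?V \<subseteq> T" using TR z(1) UI(2) by blast
    moreover have "f v = (a \<oplus> b) \<otimes> v" if v: "v \<in> ?V" for v
    proof -
      obtain u r where ur: "u \<in> U" "r \<in> carrier R" "v = u \<oplus> z \<otimes> r" using v by blast
      have uT: "u \<in> T" "u \<in> carrier R" using ur(1) UI(2) TR(1) by auto
      have "(a \<oplus> b) \<otimes> v = (a \<otimes> u \<oplus> b \<otimes> u) \<oplus> (a \<otimes> z \<oplus> b \<otimes> z) \<otimes> r"
        using ur(2,3) uT zR a(1) b(1) by (simp add: l_distr r_distr m_assoc a_ac)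
      also have "\<dots> = a \<otimes> u \<oplus> f z \<otimes> r"
        using b(2)[OF ur(1)] b(3) a(1) uT zR fz unfolding c_def
        by (simp add: minus_eq a_comm[of "f z"] r_neg1 a_assoc[symmetric] r_neg)
      also have "\<dots> = f u \<oplus> f (z \<otimes> r)" using a(2)[OF ur(1)] mult[OF z(1) ur(2)] by simp
      also have "\<dots> = f v" using add[OF uT(1) TR(4)[OF z(1) ur(2)]] ur(3) by simp
      finally show ?thesis by simp
    qed
    then have "\<exists>d\<in>carrier R. \<forall>v\<in>?V. f v = d \<otimes> v"
      using a(1) b(1) by (intro bexI[of _ "a \<oplus> b"]) auto
    ultimately have "?V \<in> \<F>" using V(1) unfolding \<F>_def by simp
    then have "?V = U" using U(2) V(2) by blast
    then show False using V(3) z(2) by simp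
  qed
  then show ?thesis using a by blast
qed

end

section \<open>Baer's criterion\<close>

context right_module
begin

text \<open>
  The graph of a homomorphism from a submodule of \<open>M\<close> to \<open>R\<close>: a submodule of \<open>M \<times> R\<close> that is single-valued at zero, and
  hence everywhere. With graphs, extending a homomorphism is inclusion, and unions of chains are immediate.
\<close>

definition partial_hom :: "('c \<times> 'a) set \<Rightarrow> bool" where
  "partial_hom P \<longleftrightarrow> P \<subseteq> carrier M \<times> carrier R \<and> (\<zero>\<^bsub>M\<^esub>, \<zero>\<^bsub>R\<^esub>) \<in> P \<and>
     (\<forall>u v u' v'. (u, v) \<in> P \<and> (u', v') \<in> P \<longrightarrow> (u \<oplus>\<^bsub>M\<^esub> u', v \<oplus>\<^bsub>R\<^esub> v') \<in> P) \<and>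
     (\<forall>u v a. (u, v) \<in> P \<and> a \<in> carrier R \<longrightarrow> (u \<cdot>\<^bsub>M\<^esub> a, v \<otimes>\<^bsub>R\<^esub> a) \<in> P) \<and>
     (\<forall>v. (\<zero>\<^bsub>M\<^esub>, v) \<in> P \<longrightarrow> v = \<zero>\<^bsub>R\<^esub>)"

lemma partial_homD:
  assumes "partial_hom P"
  shows "(u, v) \<in> P \<Longrightarrow> u \<in> carrier M" "(u, v) \<in> P \<Longrightarrow> v \<in> carrier R"
    "(\<zero>\<^bsub>M\<^esub>, \<zero>\<^bsub>R\<^esub>) \<in> P"
    "(u, v) \<in> P \<Longrightarrow> (u', v') \<in> P \<Longrightarrow> (u \<oplus>\<^bsub>M\<^esub> u', v \<oplus>\<^bsub>R\<^esub> v') \<in> P"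
    "(u, v) \<in> P \<Longrightarrow> a \<in> carrier R \<Longrightarrow> (u \<cdot>\<^bsub>M\<^esub> a, v \<otimes>\<^bsub>R\<^esub> a) \<in> P"
    "(\<zero>\<^bsub>M\<^esub>, v) \<in> P \<Longrightarrow> v = \<zero>\<^bsub>R\<^esub>"
  using assms unfolding partial_hom_def by auto

lemma partial_hom_neg:
  assumes "partial_hom P" "(u, v) \<in> P"
  shows "(\<ominus>\<^bsub>M\<^esub> u, \<ominus>\<^bsub>R\<^esub> v) \<in> P"
  using partial_homD(5)[OF assms, of "\<ominus>\<^bsub>R\<^esub> \<one>\<^bsub>R\<^esub>"] partial_homD(1,2)[OF assms]
  by (simp add: rsmult_minus_one R.r_minus)

lemma partial_hom_unique:
  assumes P: "partial_hom P" and uv: "(u, v) \<in> P" and uw: "(u, w) \<in> P"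
  shows "v = w"
proof -
  have R: "u \<in> carrier M" "v \<in> carrier R" "w \<in> carrier R"
    using partial_homD(1,2)[OF P] uv uw by auto
  have "(u \<oplus>\<^bsub>M\<^esub> \<ominus>\<^bsub>M\<^esub> u, v \<oplus>\<^bsub>R\<^esub> \<ominus>\<^bsub>R\<^esub> w) \<in> P"
    using partial_homD(4)[OF P uv partial_hom_neg[OF P uw]] .
  then have "v \<ominus>\<^bsub>R\<^esub> w = \<zero>\<^bsub>R\<^esub>" using partial_homD(6)[OF P] R by (simp add: M.r_neg R.minus_eq)
  then show ?thesis using R by simp
qed

lemma partial_hom_Union:
  assumes ne: "\<C> \<noteq> {}" and chain: "subset.chain {P. partial_hom P} \<C>"
  shows "partial_hom (\<Union>\<C>)"
proof -
  have ph: "partial_hom P" if "P \<in> \<C>" for P using chain that unfolding subset.chain_def by blast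
  have common: "\<exists>P\<in>\<C>. p \<in> P \<and> q \<in> P" if "p \<in> \<Union>\<C>" "q \<in> \<Union>\<C>" for p q
  proof -
    obtain P Q where PQ: "P \<in> \<C>" "Q \<in> \<C>" "p \<in> P" "q \<in> Q" using \<open>p \<in> _\<close> \<open>q \<in> _\<close> by blast
    then have "P \<subseteq> Q \<or> Q \<subseteq> P" using chain unfolding subset.chain_def by blast
    then show ?thesis using PQ by blast
  qed
  show ?thesis
    unfolding partial_hom_def
  proof (intro conjI allI impI)
    show "\<Union>\<C> \<subseteq> carrier M \<times> carrier R" using ph unfolding partial_hom_def by blast
    show "(\<zero>\<^bsub>M\<^esub>, \<zero>\<^bsub>R\<^esub>) \<in> \<Union>\<C>" using ne ph partial_homD(3) by blast
  next
    fix u v u' v' assume "(u, v) \<in> \<Union>\<C> \<and> (u', v') \<in> \<Union>\<C>"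
    then obtain P where "P \<in> \<C>" "(u, v) \<in> P" "(u', v') \<in> P" using common by blast
    then show "(u \<oplus>\<^bsub>M\<^esub> u', v \<oplus>\<^bsub>R\<^esub> v') \<in> \<Union>\<C>" using partial_homD(4)[OF ph] by blast
  next
    fix u v a assume "(u, v) \<in> \<Union>\<C> \<and> a \<in> carrier R"
    then show "(u \<cdot>\<^bsub>M\<^esub> a, v \<otimes>\<^bsub>R\<^esub> a) \<in> \<Union>\<C>" using partial_homD(5)[OF ph] by blast
  next
    fix v assume "(\<zero>\<^bsub>M\<^esub>, v) \<in> \<Union>\<C>"
    then show "v = \<zero>\<^bsub>R\<^esub>" using partial_homD(6)[OF ph] by blast
  qed
qed

text \<open>
  The new graph consists of the pairs \<open>(u + x r, v + a r)\<close>. The compatibility condition is exactly what makes it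
  single-valued at zero.
\<close>

lemma partial_hom_extend:
  assumes P: "partial_hom P" and x: "x \<in> carrier M" and a: "a \<in> carrier R"
    and compatible: "\<And>r v. r \<in> carrier R \<Longrightarrow> (x \<cdot>\<^bsub>M\<^esub> r, v) \<in> P \<Longrightarrow> v = a \<otimes>\<^bsub>R\<^esub> r"
  shows "\<exists>Q. partial_hom Q \<and> P \<subseteq> Q \<and> (x, a) \<in> Q"
proof -
  define Q where
    "Q = {(u \<oplus>\<^bsub>M\<^esub> x \<cdot>\<^bsub>M\<^esub> r, v \<oplus>\<^bsub>R\<^esub> a \<otimes>\<^bsub>R\<^esub> r) | u v r. (u, v) \<in> P \<and> r \<in> carrier R}"
  note PD = partial_homD[OF P]
  have QI: "(u', v') \<in> Q"
    if "(u, v) \<in> P" "r \<in> carrier R" "u' = u \<oplus>\<^bsub>M\<^esub> x \<cdot>\<^bsub>M\<^esub> r" "v' = v \<oplus>\<^bsub>R\<^esub> a \<otimes>\<^bsub>R\<^esub> r" for u v r u' v'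
    unfolding Q_def using that by blast
  have QE: "\<exists>u v r. (u, v) \<in> P \<and> r \<in> carrier R \<and> u' = u \<oplus>\<^bsub>M\<^esub> x \<cdot>\<^bsub>M\<^esub> r \<and> v' = v \<oplus>\<^bsub>R\<^esub> a \<otimes>\<^bsub>R\<^esub> r"
    if "(u', v') \<in> Q" for u' v'
    using that unfolding Q_def by blast
  have "P \<subseteq> Q"
  proof (rule subrelI)
    fix u v assume uv: "(u, v) \<in> P"
    then show "(u, v) \<in> Q"
      using PD(1,2)[OF uv] x a by (intro QI[OF uv R.zero_closed]) (simp_all add: rsmult_zero_right)
  qed
  moreover have "(x, a) \<in> Q"
    using x a by (intro QI[OF PD(3) R.one_closed]) (simp_all add: rsmult_one)
  moreover have "partial_hom Q"
    unfolding partial_hom_def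
  proof (intro conjI allI impI)
    show "Q \<subseteq> carrier M \<times> carrier R"
      unfolding Q_def using PD(1,2) x a rsmult_closed by auto
    show "(\<zero>\<^bsub>M\<^esub>, \<zero>\<^bsub>R\<^esub>) \<in> Q" using \<open>P \<subseteq> Q\<close> PD(3) by blast
  next
    fix u1 v1 u2 v2 assume "(u1, v1) \<in> Q \<and> (u2, v2) \<in> Q"
    then obtain u v r u' v' r' where
      *: "(u, v) \<in> P" "r \<in> carrier R" "u1 = u \<oplus>\<^bsub>M\<^esub> x \<cdot>\<^bsub>M\<^esub> r" "v1 = v \<oplus>\<^bsub>R\<^esub> a \<otimes>\<^bsub>R\<^esub> r"
      "(u', v') \<in> P" "r' \<in> carrier R" "u2 = u' \<oplus>\<^bsub>M\<^esub> x \<cdot>\<^bsub>M\<^esub> r'" "v2 = v' \<oplus>\<^bsub>R\<^esub> a \<otimes>\<^bsub>R\<^esub> r'"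
      using QE by metis
    note C = PD(1,2)[OF *(1)] PD(1,2)[OF *(5)] x a *(2,6)
    show "(u1 \<oplus>\<^bsub>M\<^esub> u2, v1 \<oplus>\<^bsub>R\<^esub> v2) \<in> Q"
    proof (rule QI[OF PD(4)[OF *(1,5)], of "r \<oplus>\<^bsub>R\<^esub> r'"])
      show "u1 \<oplus>\<^bsub>M\<^esub> u2 = u \<oplus>\<^bsub>M\<^esub> u' \<oplus>\<^bsub>M\<^esub> x \<cdot>\<^bsub>M\<^esub> (r \<oplus>\<^bsub>R\<^esub> r')"
        using C *(3,7) by (simp add: rsmult_closed rsmult_r_distr M.a_ac)
      show "v1 \<oplus>\<^bsub>R\<^esub> v2 = v \<oplus>\<^bsub>R\<^esub> v' \<oplus>\<^bsub>R\<^esub> a \<otimes>\<^bsub>R\<^esub> (r \<oplus>\<^bsub>R\<^esub> r')"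
        using C *(4,8) by (simp add: R.r_distr R.a_ac)
    qed (use C in simp)
  next
    fix u1 v1 b assume "(u1, v1) \<in> Q \<and> b \<in> carrier R"
    then obtain u v r where *: "(u, v) \<in> P" "r \<in> carrier R" "u1 = u \<oplus>\<^bsub>M\<^esub> x \<cdot>\<^bsub>M\<^esub> r"
      "v1 = v \<oplus>\<^bsub>R\<^esub> a \<otimes>\<^bsub>R\<^esub> r" and b: "b \<in> carrier R" using QE by metis
    note C = PD(1,2)[OF *(1)] x a *(2) b
    show "(u1 \<cdot>\<^bsub>M\<^esub> b, v1 \<otimes>\<^bsub>R\<^esub> b) \<in> Q"
    proof (rule QI[OF PD(5)[OF *(1) b], of "r \<otimes>\<^bsub>R\<^esub> b"])
      show "u1 \<cdot>\<^bsub>M\<^esub> b = u \<cdot>\<^bsub>M\<^esub> b \<oplus>\<^bsub>M\<^esub> x \<cdot>\<^bsub>M\<^esub> (r \<otimes>\<^bsub>R\<^esub> b)"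
        using C *(3) by (simp add: rsmult_closed rsmult_l_distr rsmult_assoc)
      show "v1 \<otimes>\<^bsub>R\<^esub> b = v \<otimes>\<^bsub>R\<^esub> b \<oplus>\<^bsub>R\<^esub> a \<otimes>\<^bsub>R\<^esub> (r \<otimes>\<^bsub>R\<^esub> b)"
        using C *(4) by (simp add: R.l_distr R.m_assoc)
    qed (use C in simp)
  next
    fix v1 assume "(\<zero>\<^bsub>M\<^esub>, v1) \<in> Q"
    then obtain u v r where *: "(u, v) \<in> P" "r \<in> carrier R" "\<zero>\<^bsub>M\<^esub> = u \<oplus>\<^bsub>M\<^esub> x \<cdot>\<^bsub>M\<^esub> r"
      "v1 = v \<oplus>\<^bsub>R\<^esub> a \<otimes>\<^bsub>R\<^esub> r" using QE by metis
    note C = PD(1,2)[OF *(1)] x a *(2)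
    have "x \<cdot>\<^bsub>M\<^esub> r = \<ominus>\<^bsub>M\<^esub> u"
      using C *(3) rsmult_closed M.minus_equality[of "x \<cdot>\<^bsub>M\<^esub> r" u] by (simp add: M.a_comm)
    then have "\<ominus>\<^bsub>R\<^esub> v = a \<otimes>\<^bsub>R\<^esub> r"
      using compatible[OF *(2)] partial_hom_neg[OF P *(1)] by simp
    then have "v1 = v \<oplus>\<^bsub>R\<^esub> \<ominus>\<^bsub>R\<^esub> v" using *(4) by simp
    then show "v1 = \<zero>\<^bsub>R\<^esub>" using C by (simp add: R.r_neg)
  qed
  ultimately show ?thesis by blast
qed

end

text \<open>
  Take a maximal extension \<open>P\<close> of \<open>f\<close>. For \<open>x\<close> in \<open>M\<close> the elements \<open>r\<close> with \<open>x r\<close> in the domain of \<open>P\<close> form a right ideal, and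
  \<open>r \<mapsto> P (x r)\<close> is multiplication by some \<open>a\<close>; so \<open>P\<close> extends to \<open>x\<close> by the value \<open>a\<close>, and by maximality \<open>x\<close> is
  already in its domain.
\<close>

lemma (in ring) baer_criterion:
  assumes baer: "\<And>T f. right_ideal R T \<Longrightarrow> (\<And>u. u \<in> T \<Longrightarrow> f u \<in> carrier R) \<Longrightarrow>
      (\<And>u v. u \<in> T \<Longrightarrow> v \<in> T \<Longrightarrow> f (u \<oplus> v) = f u \<oplus> f v) \<Longrightarrow>
      (\<And>u a. u \<in> T \<Longrightarrow> a \<in> carrier R \<Longrightarrow> f (u \<otimes> a) = f u \<otimes> a) \<Longrightarrow>
      \<exists>a\<in>carrier R. \<forall>u\<in>T. f u = a \<otimes> u"
  shows "injective_right_module TYPE('m) R (regular_right_module R)"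
  unfolding injective_right_module_def
proof (intro conjI allI impI right_module_regular)
  fix M :: "('a, 'm) right_module" and N f
  assume "right_module R M \<and> right_submodule R N M \<and>
    f \<in> right_module_hom R (M\<lparr>carrier := N\<rparr>) (regular_right_module R)"
  then have M: "right_module R M" and N: "right_submodule R N M"
    and hom: "f \<in> right_module_hom R (M\<lparr>carrier := N\<rparr>) (regular_right_module R)"
    by auto
  interpret M: right_module R M by (rule M)
  have sub: "N \<subseteq> carrier M" "\<zero>\<^bsub>M\<^esub> \<in> N" "\<And>x y. x \<in> N \<Longrightarrow> y \<in> N \<Longrightarrow> x \<oplus>\<^bsub>M\<^esub> y \<in> N"
    "\<And>x a. x \<in> N \<Longrightarrow> a \<in> carrier R \<Longrightarrow> x \<cdot>\<^bsub>M\<^esub> a \<in> N"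
    using N unfolding M.right_submodule_iff by auto
  have f: "\<And>x. x \<in> N \<Longrightarrow> f x \<in> carrier R"
    "\<And>x y. x \<in> N \<Longrightarrow> y \<in> N \<Longrightarrow> f (x \<oplus>\<^bsub>M\<^esub> y) = f x \<oplus> f y"
    "\<And>x a. x \<in> N \<Longrightarrow> a \<in> carrier R \<Longrightarrow> f (x \<cdot>\<^bsub>M\<^esub> a) = f x \<otimes> a"
    using hom unfolding right_module_hom_def regular_right_module_def by auto
  define G where "G = {(x, f x) | x. x \<in> N}"
  have f0: "f \<zero>\<^bsub>M\<^esub> = \<zero>"
    using f(3)[OF sub(2) zero_closed] f(1)[OF sub(2)] M.rsmult_zero_right[OF M.M.zero_closed] by simp
  have G: "M.partial_hom G"
    unfolding M.partial_hom_def G_def using sub f f0 by auto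
  define \<A> where "\<A> = {P. M.partial_hom P \<and> G \<subseteq> P}"
  have "\<exists>P\<in>\<A>. \<forall>Q\<in>\<A>. P \<subseteq> Q \<longrightarrow> Q = P"
  proof (rule subset_Zorn_nonempty)
    show "\<A> \<noteq> {}" using G unfolding \<A>_def by blast
  next
    fix \<C> assume \<C>: "\<C> \<noteq> {}" "subset.chain \<A> \<C>"
    then have "subset.chain {P. M.partial_hom P} \<C>"
      unfolding subset.chain_def \<A>_def by blast
    moreover have "G \<subseteq> \<Union>\<C>" using \<C> unfolding subset.chain_def \<A>_def by blast
    ultimately show "\<Union>\<C> \<in> \<A>" using M.partial_hom_Union \<C>(1) unfolding \<A>_def by blast
  qed
  then obtain P where "P \<in> \<A>" and max: "\<And>Q. Q \<in> \<A> \<Longrightarrow> P \<subseteq> Q \<Longrightarrow> Q = P" by blast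
  then have P: "M.partial_hom P" and GP: "G \<subseteq> P" unfolding \<A>_def by auto
  note PD = M.partial_homD[OF P]
  have total: "\<exists>v. (x, v) \<in> P" if x: "x \<in> carrier M" for x
  proof -
    define T where "T = {r \<in> carrier R. \<exists>v. (x \<cdot>\<^bsub>M\<^esub> r, v) \<in> P}"
    define h where "h r = (THE v. (x \<cdot>\<^bsub>M\<^esub> r, v) \<in> P)" for r
    have h: "h r = v" if "(x \<cdot>\<^bsub>M\<^esub> r, v) \<in> P" for r v
      unfolding h_def using that M.partial_hom_unique[OF P] by blast
    have T_add: "(x \<cdot>\<^bsub>M\<^esub> (r \<oplus> s), v \<oplus> w) \<in> P"
      if "r \<in> carrier R" "s \<in> carrier R" "(x \<cdot>\<^bsub>M\<^esub> r, v) \<in> P" "(x \<cdot>\<^bsub>M\<^esub> s, w) \<in> P" for r s v w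
      using PD(4)[OF that(3,4)] x that(1,2) by (simp add: M.rsmult_r_distr)
    have T_mult: "(x \<cdot>\<^bsub>M\<^esub> (r \<otimes> a), v \<otimes> a) \<in> P"
      if "r \<in> carrier R" "a \<in> carrier R" "(x \<cdot>\<^bsub>M\<^esub> r, v) \<in> P" for r a v
      using PD(5)[OF that(3,2)] x that(1,2) by (simp add: M.rsmult_assoc)
    have T: "right_ideal R T"
      unfolding right_ideal_iff
    proof (intro conjI ballI)
      show "T \<subseteq> carrier R" unfolding T_def by blast
      show "\<zero> \<in> T" unfolding T_def using PD(3) M.rsmult_zero_right[OF x] by auto
    next
      fix r s assume "r \<in> T" "s \<in> T"
      then show "r \<oplus> s \<in> T" unfolding T_def using T_add by blast
    next
      fix r a assume "r \<in> T" "a \<in> carrier R"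
      then show "r \<otimes> a \<in> T" unfolding T_def using T_mult by blast
    qed
    have "\<exists>a\<in>carrier R. \<forall>r\<in>T. h r = a \<otimes> r"
    proof (rule baer[OF T])
      fix r assume "r \<in> T"
      then obtain v where "(x \<cdot>\<^bsub>M\<^esub> r, v) \<in> P" unfolding T_def by blast
      then show "h r \<in> carrier R" using h PD(2) by simp
    next
      fix r s assume "r \<in> T" "s \<in> T"
      then obtain v w where "(x \<cdot>\<^bsub>M\<^esub> r, v) \<in> P" "(x \<cdot>\<^bsub>M\<^esub> s, w) \<in> P" "r \<in> carrier R" "s \<in> carrier R"
        unfolding T_def by blast
      then show "h (r \<oplus> s) = h r \<oplus> h s" using h T_add by simp
    next
      fix r a assume "r \<in> T" and a: "a \<in> carrier R"
      then obtain v where "(x \<cdot>\<^bsub>M\<^esub> r, v) \<in> P" "r \<in> carrier R" unfolding T_def by blast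
      then show "h (r \<otimes> a) = h r \<otimes> a" using h T_mult a by simp
    qed
    then obtain a where a: "a \<in> carrier R" "\<And>r. r \<in> T \<Longrightarrow> h r = a \<otimes> r" by blast
    have "v = a \<otimes> r" if "r \<in> carrier R" "(x \<cdot>\<^bsub>M\<^esub> r, v) \<in> P" for r v
      using a(2)[of r] h[OF that(2)] that unfolding T_def by blast
    then obtain Q where Q: "M.partial_hom Q" "P \<subseteq> Q" "(x, a) \<in> Q"
      using M.partial_hom_extend[OF P x a(1)] by blast
    then have "Q = P" using max GP unfolding \<A>_def by blast
    then show ?thesis using Q(3) by blast
  qed
  define g where "g x = (THE v. (x, v) \<in> P)" for x
  have g: "g x = v" if "(x, v) \<in> P" for x v
    unfolding g_def using that M.partial_hom_unique[OF P] by blast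
  have gP: "(x, g x) \<in> P" if "x \<in> carrier M" for x using total[OF that] g by blast
  have "g \<in> right_module_hom R M (regular_right_module R)"
    unfolding right_module_hom_def regular_right_module_def
    using gP PD(2) g[OF PD(4)[OF gP gP]] g[OF PD(5)[OF gP]] by auto
  moreover have "g x = f x" if "x \<in> N" for x using g GP that unfolding G_def by blast
  ultimately show "\<exists>g\<in>right_module_hom R M (regular_right_module R). \<forall>x\<in>N. g x = f x" by blast
qed

theorem theorem2p15:
  fixes R :: "('a, 'b) ring_scheme"
  assumes "ring R"
    and "right_simple_injective R"
    and "acc_right_annihilators R"
    and "essential_right_submodule R (right_socle R) (regular_right_module R)"
  shows "quasi_frobenius TYPE('m) R"
proof -
  interpret right_simple_injective_acc_ring R
    using assms
    by (simp add: right_simple_injective_acc_ring_def right_simple_injective_acc_ring_axioms_def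
        right_simple_injective_ring_def right_simple_injective_ring_axioms_def)
  have "right_self_injective TYPE('m) R"
    unfolding right_self_injective_def
    by (rule baer_criterion) (rule right_ideal_hom_is_left_mult)
  then show ?thesis
    unfolding quasi_frobenius_def using assms(1) right_noetherian by blast
qed

end
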